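(* There exists an absolute constant $c>0$ such that for every finite set $B\subset\mathbb{R}$ with $|B|\ge 2$ the following hold. (i) The set $B\times B\subset\mathbb{R}^2$ satisfies \[ |\mathcal{A}(B\times B)|\ \ge\ c\,|B|^{2+\frac{1}{14}} . \] (ii) Moreover, there exists $q\in B\times B$ such that \[ \bigl|\{\mathcal{A}(p,q,r): p,r\in B\times B,\ p,q,r \text{ distinct}\}\bigr|\ \ge\ c\,|B|^{2+\frac{1}{14}} . \]
   Context: For three distinct points $p,q,r\in\mathbb{R}^2$, $\mathcal{A}(p,q,r)$ denotes the angle determined by the three points with $q$ as the centre (vertex), i.e. the angle in $[0,\pi]$ between the vectors $p-q$ and $r-q$. For a finite set $P\subset\mathbb{R}^2$, $\mathcal{A}(P):=\{\mathcal{A}(p,q,r): p,q,r\in P \text{ distinct}\}$. $|S|$ denotes the cardinality of a finite set $S$. *)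

theory Defs
  imports "HOL-Analysis.Analysis"
begin

text \<open>
  The plane is \<^typ>\<open>real \<times> real\<close>, whose library inner product and norm are the Euclidean ones.
\<close>

text \<open>
  The angle at the vertex \<open>q\<close>, in \<open>[0, \<pi>]\<close>. It is meaningful for \<open>p \<noteq> q\<close> and \<open>r \<noteq> q\<close>
  only; the sets of angles below range over such triples.
\<close>

definition angle :: "real \<times> real \<Rightarrow> real \<times> real \<Rightarrow> real \<times> real \<Rightarrow> real" where
  "angle p q r = arccos (((p - q) \<bullet> (r - q)) / (norm (p - q) * norm (r - q)))"

definition angles_at :: "real \<times> real \<Rightarrow> (real \<times> real) set \<Rightarrow> real set" where
  "angles_at q P = {angle p q r | p r. p \<in> P \<and> r \<in> P \<and> p \<noteq> q \<and> q \<noteq> r \<and> p \<noteq> r}"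

definition angles :: "(real \<times> real) set \<Rightarrow> real set" where
  "angles P = {angle p q r | p q r. p \<in> P \<and> q \<in> P \<and> r \<in> P \<and> p \<noteq> q \<and> q \<noteq> r \<and> p \<noteq> r}"

end

theory Submission
  imports Defs
begin

text \<open>
  Fix a vertex \<open>q\<close> and let \<open>\<Theta>\<close> be the set of directions, modulo \<open>\<pi>\<close>, of the lines joining \<open>q\<close> to the
  grid \<open>B \<times> B\<close>, where \<open>n = |B|\<close>. The angles at \<open>q\<close> are, up to a bounded multiplicity, the elements of \<open>\<Theta> - \<Theta>\<close>. For a suitable
  \<open>q\<close> there are at least a constant times \<open>n\<^sup>2\<close> directions, by an elementary incidence bound of
  Szemeredi-Trotter strength for grids. For every \<open>q\<close>, a convexity argument gives
  \<open>|4\<Theta> - 3\<Theta>| \<ge> c n\<^bsup>5/2\<^esup>\<close>. The Pluennecke-Ruzsa inequality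
  \<open>|4\<Theta> - 3\<Theta>| |\<Theta>|\<^sup>6 \<le> |\<Theta> - \<Theta>|\<^sup>7\<close> then yields \<open>|\<Theta> - \<Theta>|\<^sup>7 \<ge> c n\<^bsup>29/2\<^esup>\<close>, which is the exponent
  \<open>29/14 = 2 + 1/14\<close>.
\<close>

section \<open>Sumset inequalities\<close>

text \<open>Counting directions alone gives |\<Theta> - \<Theta>| of order n^2 and no more, so the
  gain has to come from the additive structure of \<Theta>. If \<Theta> had few differences,
  Pluennecke-Ruzsa would keep |4\<Theta> - 3\<Theta>| close to |\<Theta>|, which is at most n^2. The
  signs 4 and 3 come from the elements that are counted. Each is one direction, plus a value of a
  function g that is a difference of two directions, plus an increment of g, which has two
  directions of each sign. There are about n choices for the first direction, n for the value of g
  and, on average, sqrt n for the increment. The last number is sqrt n and not n because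
  \<open>B\<close> is arbitrary: one function g alone may have all its increments equal. Two such
  functions cannot repeat the same pair of increments, and about n distinct pairs force about sqrt n
  distinct values in one of the two coordinates. The vertex is chosen only to make \<Theta> large,
  which matters through the factor |\<Theta>|^6.\<close>

lemma petridis:
  fixes X B C :: "'a::ab_group_add set"
  assumes "finite X" "finite B" "finite C"
    and minim: "\<And>Z. Z \<subseteq> X \<Longrightarrow> card (X + B) * card Z \<le> card (Z + B) * card X"
  shows "card (X + B + C) * card X \<le> card (X + B) * card (X + C)"
  using assms(3)
proof (induction C rule: finite_induct)
  case empty
  then show ?case by (simp add: set_plus_def)
next
  case (insert c C)
  \<comment> \<open>Adding \<open>c\<close> creates at most |X + B| - |Z + B| new elements of
    \<open>X + B + C\<close>, since the translates \<open>x + B + c\<close> with \<open>x\<close> in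
    \<open>Z\<close> are already present. It creates exactly |X| - |W| new elements of
    \<open>X + C\<close>. As \<open>W\<close> is contained in \<open>Z\<close>, minimality applied
    to \<open>Z\<close> compares the two increases.\<close>
  define Z where "Z = {x \<in> X. \<forall>b\<in>B. x + b + c \<in> X + B + C}"
  define W where "W = {x \<in> X. x + c \<in> X + C}"
  have fin: "finite (X + B)" "finite (X + B + C)" "finite (X + C)" "finite (Z + B)"
    using assms(1,2) insert.hyps by (auto intro!: finite_set_plus simp: Z_def)
  have shift: "inj_on (\<lambda>u. u + c) A" for A by (simp add: inj_on_def)
  have "X + B + insert c C \<subseteq> (X + B + C) \<union> (\<lambda>u. u + c) ` ((X + B) - (Z + B))"
  proof
    fix u assume "u \<in> X + B + insert c C"
    then obtain x b d where u: "x \<in> X" "b \<in> B" "d \<in> insert c C" "u = x + b + d"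
      by (auto simp: set_plus_def)
    show "u \<in> (X + B + C) \<union> (\<lambda>u. u + c) ` ((X + B) - (Z + B))"
    proof (cases "d \<in> C")
      case True
      then show ?thesis using u by (blast intro: set_plus_intro)
    next
      case False
      then have d: "d = c" using u by blast
      show ?thesis
      proof (cases "x + b \<in> Z + B")
        case True
        then obtain z b' where z: "z \<in> Z" "b' \<in> B" "x + b = z + b'" by (auto simp: set_plus_def)
        then have "z + b' + c \<in> X + B + C" by (auto simp: Z_def)
        then have "u \<in> X + B + C" unfolding u(4) d z(3) .
        then show ?thesis by blast
      next
        case False
        then have "x + b \<in> (X + B) - (Z + B)" using u by (blast intro: set_plus_intro)
        then show ?thesis using u d by blast
      qed
    qed
  qed
  then have "card (X + B + insert c C) \<le> card ((X + B + C) \<union> (\<lambda>u. u + c) ` ((X + B) - (Z + B)))"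
    using fin by (intro card_mono) auto
  also have "\<dots> \<le> card (X + B + C) + card ((X + B) - (Z + B))"
    using card_Un_le card_image[OF shift] by metis
  also have "card ((X + B) - (Z + B)) = card (X + B) - card (Z + B)"
    using fin by (intro card_Diff_subset) (auto simp: Z_def set_plus_def)
  finally have up: "card (X + B + insert c C) \<le> card (X + B + C) + (card (X + B) - card (Z + B))" .
  have ZB: "card (Z + B) \<le> card (X + B)"
    using fin by (intro card_mono) (auto simp: Z_def set_plus_def)
  have "X + insert c C = (X + C) \<union> (\<lambda>u. u + c) ` (X - W)"
    by (auto simp: set_plus_def W_def)
  moreover have "(X + C) \<inter> (\<lambda>u. u + c) ` (X - W) = {}" by (auto simp: W_def)
  ultimately have "card (X + insert c C) = card (X + C) + card (X - W)"
    using fin assms(1) card_image[OF shift]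
    by (simp add: card_Un_disjoint)
  also have "card (X - W) = card X - card W"
    using assms(1) by (intro card_Diff_subset) (auto simp: W_def)
  finally have lo: "card (X + insert c C) = card (X + C) + (card X - card W)" .
  have WX: "card W \<le> card X" using assms(1) by (intro card_mono) (auto simp: W_def)
  have "W \<subseteq> Z"
  proof
    fix x assume "x \<in> W"
    then obtain x' d where x: "x \<in> X" "x' \<in> X" "d \<in> C" "x + c = x' + d"
      by (auto simp: W_def set_plus_def)
    have "x + b + c \<in> X + B + C" if "b \<in> B" for b
    proof -
      have "x + b + c = x' + b + d" using x(4) by (metis add.assoc add.commute)
      moreover have "x' + b + d \<in> X + B + C" using x that by (blast intro: set_plus_intro)
      ultimately show ?thesis by (simp only:)
    qed
    then show "x \<in> Z" using x by (simp add: Z_def)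
  qed
  then have "card W \<le> card Z" using assms(1) by (intro card_mono) (auto simp: Z_def)
  then have "card (X + B) * card W \<le> card (Z + B) * card X"
    using minim[of Z] by (auto simp: Z_def intro: order_trans mult_le_mono2)
  then have "(card (X + B + C) + (card (X + B) - card (Z + B))) * card X
      \<le> card (X + B) * (card (X + C) + (card X - card W))"
    using insert.IH ZB WX
    by (simp add: algebra_simps diff_mult_distrib diff_mult_distrib2)
  then show ?case using up lo by (metis order_trans mult_le_mono1)
qed

text \<open>The witness minimises |X + B| / |X| over the nonempty subsets of \<open>A\<close>.
  Cross-multiplication lets the second comparison include \<open>Z = {}\<close>.\<close>

lemma ex_min_ratio:
  fixes A B :: "'a::ab_group_add set"
  assumes "finite A" "A \<noteq> {}"
  obtains X where "X \<subseteq> A" "X \<noteq> {}" "card (X + B) * card A \<le> card (A + B) * card X"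
    "\<And>Z. Z \<subseteq> X \<Longrightarrow> card (X + B) * card Z \<le> card (Z + B) * card X"
proof -
  let ?r = "\<lambda>X. real (card (X + B)) / card X"
  have "finite (Pow A - {{}})" "Pow A - {{}} \<noteq> {}" using assms by auto
  from ex_is_arg_min_if_finite[OF this, of ?r]
  obtain X where "is_arg_min ?r (\<lambda>X. X \<in> Pow A - {{}}) X" by blast
  then have X: "X \<in> Pow A - {{}}" "\<And>Y. Y \<in> Pow A - {{}} \<Longrightarrow> \<not> ?r Y < ?r X"
    unfolding is_arg_min_def by blast+
  have *: "card (X + B) * card Y \<le> card (Y + B) * card X" if "Y \<subseteq> A" for Y
  proof (cases "Y = {}")
    case False
    have pos: "card X > 0" "card Y > 0" using that False X assms(1)
      by (auto simp: card_gt_0_iff intro: finite_subset)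
    have "?r X \<le> ?r Y" using X(2)[of Y] that False by auto
    then have "real (card (X + B)) * card Y \<le> card (Y + B) * card X"
      using pos by (simp add: field_simps)
    then show ?thesis by (metis of_nat_le_iff of_nat_mult)
  qed auto
  show thesis
    by (rule that[of X]) (use X * in auto)
qed

text \<open>\<open>((+) B ^^ h) {0}\<close> is the h-fold sumset of \<open>B\<close>. With this set
  in the role of \<open>C\<close>, \<open>petridis\<close> shows that each further summand
  \<open>B\<close> costs a factor |X + B| / |X|.\<close>

lemma iterated_sumset_card:
  fixes X B :: "'a::ab_group_add set"
  assumes "finite X" "X \<noteq> {}" "finite B"
    and "\<And>Z. Z \<subseteq> X \<Longrightarrow> card (X + B) * card Z \<le> card (Z + B) * card X"
  shows "finite (((+) B ^^ h) {0}) \<and>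
    real (card (X + ((+) B ^^ h) {0})) \<le> (real (card (X + B)) / card X) ^ h * card X"
proof (induction h)
  case 0
  then show ?case by (simp add: set_plus_def)
next
  case (Suc h)
  let ?C = "((+) B ^^ h) {0}"
  have pos: "card X > 0" using assms by (simp add: card_gt_0_iff)
  have "card (X + B + ?C) * card X \<le> card (X + B) * card (X + ?C)"
    using Suc assms by (intro petridis) auto
  then have "real (card (X + B + ?C)) * card X \<le> card (X + B) * real (card (X + ?C))"
    by (metis of_nat_le_iff of_nat_mult)
  then have "real (card (X + B + ?C)) \<le> real (card (X + B)) / card X * card (X + ?C)"
    using pos by (simp add: field_simps)
  also have "\<dots> \<le> real (card (X + B)) / card X * ((real (card (X + B)) / card X) ^ h * card X)"
    using Suc by (intro mult_left_mono) auto
  finally show ?case using Suc assms(3)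
    by (simp add: add.assoc finite_set_plus)
qed

text \<open>Fix one representation d = f d - g d of every difference. The pair (x + f d, x + g d)
  determines d as the difference of its coordinates, and then x.\<close>

lemma ruzsa_triangle:
  fixes X Y Z :: "'a::ab_group_add set"
  assumes "finite X" "finite Y" "finite Z"
  shows "card X * card (Y + uminus ` Z) \<le> card (X + Y) * card (X + Z)"
proof -
  let ?D = "Y + uminus ` Z"
  have "\<forall>d\<in>?D. \<exists>y z. y \<in> Y \<and> z \<in> Z \<and> d = y - z"
    by (auto simp: set_plus_def)
  then obtain f g where fg: "\<And>d. d \<in> ?D \<Longrightarrow> f d \<in> Y \<and> g d \<in> Z \<and> d = f d - g d" by metis
  let ?h = "\<lambda>(x, d). (x + f d, x + g d)"
  have "inj_on ?h (X \<times> ?D)"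
  proof (rule inj_onI, clarify)
    fix x d x' d'
    assume "d \<in> ?D" "d' \<in> ?D" and eq: "x + f d = x' + f d'" "x + g d = x' + g d'"
    then have "d = f d - g d" "d' = f d' - g d'" using fg by blast+
    moreover have "f d - g d = f d' - g d'" using eq by (metis add_diff_cancel_left)
    ultimately show "x = x' \<and> d = d'" using eq by auto
  qed
  moreover have "?h ` (X \<times> ?D) \<subseteq> (X + Y) \<times> (X + Z)" using fg by (auto intro!: set_plus_intro)
  ultimately have "card (X \<times> ?D) \<le> card ((X + Y) \<times> (X + Z))"
    using assms by (intro card_inj_on_le) (auto intro: finite_set_plus)
  then show ?thesis by (simp add: card_cartesian_product)
qed

definition sums_4_3 :: "'a::ab_group_add set \<Rightarrow> 'a set" where
  "sums_4_3 A = {a + b + c + d - (e + f + g) | a b c d e f g.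
     a \<in> A \<and> b \<in> A \<and> c \<in> A \<and> d \<in> A \<and> e \<in> A \<and> f \<in> A \<and> g \<in> A}"

lemma finite_sums_4_3:
  assumes "finite A" shows "finite (sums_4_3 A)"
proof -
  let ?h = "\<lambda>(a, b, c, d, e, f, g). a + b + c + d - (e + f + g)"
  have "sums_4_3 A \<subseteq> ?h ` (A \<times> A \<times> A \<times> A \<times> A \<times> A \<times> A)"
  proof
    fix s assume "s \<in> sums_4_3 A"
    then obtain a b c d e f g where "s = a + b + c + d - (e + f + g)"
      "a \<in> A" "b \<in> A" "c \<in> A" "d \<in> A" "e \<in> A" "f \<in> A" "g \<in> A"
      unfolding sums_4_3_def by blast
    then show "s \<in> ?h ` (A \<times> A \<times> A \<times> A \<times> A \<times> A \<times> A)"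
      by (intro image_eqI[of _ _ "(a, b, c, d, e, f, g)"]) simp_all
  qed
  then show ?thesis using assms by (auto intro: finite_subset)
qed

text \<open>For B = -A one has 4A - 3A = 3B - 4B. Let X minimise the ratio K = |X + B| / |X|. The
  triangle inequality with pivot X bounds |3B - 4B| by |X + 3B| |X + 4B| / |X|, hence by K^7 |X|;
  finally |X| \<le> |A| and K |A| \<le> |A - A|.\<close>

lemma plunnecke_4_3:
  fixes A :: "'a::ab_group_add set"
  assumes "finite A"
  shows "card (sums_4_3 A) * card A ^ 6 \<le> card (A + uminus ` A) ^ 7"
proof (cases "A = {}")
  case False
  let ?B = "uminus ` A"
  let ?n = "\<lambda>h. ((+) ?B ^^ h) {0}"
  obtain X where X: "X \<subseteq> A" "X \<noteq> {}" "card (X + ?B) * card A \<le> card (A + ?B) * card X"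
    "\<And>Z. Z \<subseteq> X \<Longrightarrow> card (X + ?B) * card Z \<le> card (Z + ?B) * card X"
    using ex_min_ratio[OF assms(1) False] by metis
  have finX: "finite X" using X(1) assms(1) finite_subset by blast
  have pos: "card X > 0" "card A > 0" using X finX assms(1) False by (auto simp: card_gt_0_iff)
  define K where "K = real (card (X + ?B)) / card X"
  have it: "finite (?n h)" "real (card (X + ?n h)) \<le> K ^ h * card X" for h
    using iterated_sumset_card[OF finX X(2) finite_imageI[OF assms(1)] X(4)]
    unfolding K_def by auto
  have "real (card (X + ?B)) * card A \<le> card (A + ?B) * real (card X)"
    using X(3) by (metis of_nat_le_iff of_nat_mult)
  then have K: "K * card A \<le> card (A + ?B)" "K \<ge> 0"
    unfolding K_def using pos by (simp_all add: field_simps)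
  have "sums_4_3 A \<subseteq> ?n 3 + uminus ` ?n 4"
  proof
    fix s assume "s \<in> sums_4_3 A"
    then obtain a b c d e f g where s: "s = a + b + c + d - (e + f + g)"
      "a \<in> A" "b \<in> A" "c \<in> A" "d \<in> A" "e \<in> A" "f \<in> A" "g \<in> A"
      unfolding sums_4_3_def by blast
    have n: "?n 3 = ?B + (?B + (?B + {0}))" "?n 4 = ?B + (?B + (?B + (?B + {0})))"
      by (simp_all add: numeral_eq_Suc)
    have "- e + (- f + (- g + 0)) \<in> ?n 3"
      unfolding n using s by (intro set_plus_intro imageI) simp_all
    moreover have "- a + (- b + (- c + (- d + 0))) \<in> ?n 4"
      unfolding n using s by (intro set_plus_intro imageI) simp_all
    ultimately have "(- e + (- f + (- g + 0))) + (- (- a + (- b + (- c + (- d + 0))))) \<in> ?n 3 + uminus ` ?n 4"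
      by (intro set_plus_intro imageI)
    then show "s \<in> ?n 3 + uminus ` ?n 4" unfolding s by (simp add: algebra_simps)
  qed
  then have "card (sums_4_3 A) \<le> card (?n 3 + uminus ` ?n 4)"
    using it by (intro card_mono finite_set_plus) auto
  moreover have "card X * card (?n 3 + uminus ` ?n 4) \<le> card (X + ?n 3) * card (X + ?n 4)"
    using finX it by (intro ruzsa_triangle) auto
  ultimately have "card X * card (sums_4_3 A) \<le> card (X + ?n 3) * card (X + ?n 4)"
    by (meson le_trans mult_le_mono2)
  then have "real (card X) * card (sums_4_3 A) \<le> real (card (X + ?n 3)) * card (X + ?n 4)"
    by (metis of_nat_le_iff of_nat_mult)
  also have "\<dots> \<le> (K ^ 3 * card X) * (K ^ 4 * card X)"
    using it K by (intro mult_mono) auto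
  also have "\<dots> = card X * (K ^ 7 * card X)" by (simp add: eval_nat_numeral)
  finally have "real (card (sums_4_3 A)) \<le> K ^ 7 * card X" using pos by simp
  also have "\<dots> \<le> K ^ 7 * card A"
    using K X(1) assms(1) by (intro mult_left_mono) (auto intro: card_mono)
  finally have "real (card (sums_4_3 A)) * card A ^ 6 \<le> K ^ 7 * card A * card A ^ 6"
    by (intro mult_right_mono) auto
  also have "\<dots> = (K * card A) ^ 7" by (simp add: power_mult_distrib eval_nat_numeral)
  also have "\<dots> \<le> real (card (A + ?B)) ^ 7" using K by (intro power_mono) auto
  finally show ?thesis by (metis (mono_tags) of_nat_le_iff of_nat_mult of_nat_power)
qed (simp add: sums_4_3_def)

section \<open>Rich lines and directions in a grid\<close>

lemma card_le_fibers:
  assumes "finite A" "\<And>y. y \<in> f ` A \<Longrightarrow> card {x \<in> A. f x = y} \<le> k"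
  shows "card A \<le> card (f ` A) * k"
proof -
  have "card A \<le> card (\<Union>y\<in>f ` A. {x \<in> A. f x = y})"
    using assms(1) by (intro card_mono) auto
  also have "\<dots> \<le> (\<Sum>y\<in>f ` A. card {x \<in> A. f x = y})"
    using assms(1) by (intro card_UN_le) auto
  also have "\<dots> \<le> card (f ` A) * k"
    using sum_bounded_above[of "f ` A" "\<lambda>y. card {x \<in> A. f x = y}" k] assms(2) by simp
  finally show ?thesis .
qed

text \<open>Every point other than the chosen representative of its \<open>h\<close>-class forms a
  colliding pair with that representative, and distinct points give distinct pairs.\<close>

lemma card_collisions_ge:
  assumes "finite L"
  shows "card L \<le> card (h ` L) + card {(r, r'). r \<in> L \<and> r' \<in> L \<and> r \<noteq> r' \<and> h r = h r'}"
    (is "_ \<le> _ + card ?R")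
proof -
  define s where "s = inv_into L h"
  have s: "s (h r) \<in> L" "h (s (h r)) = h r" if "r \<in> L" for r
    using that by (auto simp: s_def inv_into_into f_inv_into_f)
  have "L \<subseteq> s ` h ` L \<union> fst ` ?R" using s by force
  moreover have fin: "finite ?R" by (rule finite_subset[of _ "L \<times> L"]) (use assms in auto)
  ultimately have "card L \<le> card (s ` h ` L \<union> fst ` ?R)"
    using assms by (intro card_mono) auto
  also have "\<dots> \<le> card (s ` h ` L) + card (fst ` ?R)" by (rule card_Un_le)
  also have "\<dots> \<le> card (h ` L) + card ?R"
    using assms fin by (intro add_mono card_image_le) auto
  finally show ?thesis .
qed

text \<open>Ranks divided by \<open>w\<close> cut \<open>B\<close> into runs of \<open>w\<close>
  consecutive elements. Rank replaces length because the spacing of \<open>B\<close> is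
  arbitrary.\<close>

lemma ex_blocks:
  fixes B :: "real set"
  assumes "finite B" "w > 0"
  obtains \<beta> :: "real \<Rightarrow> nat" where "mono_on B \<beta>" "\<And>b. b \<in> B \<Longrightarrow> \<beta> b * w < card B"
    "\<And>t. card {b \<in> B. \<beta> b = t} \<le> w"
proof -
  define rk where "rk b = card {b' \<in> B. b' < b}" for b
  have less: "rk b < rk c" if "b \<in> B" "b < c" for b c
    unfolding rk_def using assms(1) that by (intro psubset_card_mono) auto
  have inj: "inj_on rk B"
    by (rule inj_onI) (metis less linorder_neqE_linordered_idom less_irrefl)
  have lt: "rk b < card B" if "b \<in> B" for b
    unfolding rk_def using assms(1) that by (intro psubset_card_mono) auto
  show thesis
  proof (rule that[of "\<lambda>b. rk b div w"])
    show "mono_on B (\<lambda>b. rk b div w)"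
      by (intro mono_onI div_le_mono) (metis less less_eq_real_def less_imp_le order_refl)
    show "rk b div w * w < card B" if "b \<in> B" for b
      using lt[OF that] by (metis div_times_less_eq_dividend le_less_trans)
    show "card {b \<in> B. rk b div w = t} \<le> w" for t
    proof -
      have "card {b \<in> B. rk b div w = t} \<le> card {t * w..<t * w + w}"
      proof (rule card_inj_on_le[of rk])
        show "inj_on rk {b \<in> B. rk b div w = t}" using inj by (auto simp: inj_on_def)
        show "rk ` {b \<in> B. rk b div w = t} \<subseteq> {t * w..<t * w + w}"
          using assms(2) by (auto simp: dividend_less_div_times)
            (metis add.commute dividend_less_div_times mult.commute)
      qed auto
      then show ?thesis by simp
    qed
  qed
qed

text \<open>The visited cells form a chain in the product order, and on a chain the sum of the
  coordinates is injective.\<close>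

lemma card_cells_comonotone:
  fixes f g :: "'a \<Rightarrow> nat"
  assumes bd: "\<And>r. r \<in> L \<Longrightarrow> f r < T \<and> g r < T"
    and co: "\<And>r s. r \<in> L \<Longrightarrow> s \<in> L \<Longrightarrow> (f r \<le> f s \<and> g r \<le> g s) \<or> (f s \<le> f r \<and> g s \<le> g r)"
  shows "card ((\<lambda>r. (f r, g r)) ` L) \<le> 2 * T"
proof -
  have "card ((\<lambda>r. (f r, g r)) ` L) \<le> card {..<2 * T}"
  proof (rule card_inj_on_le[of "\<lambda>(u, v). u + v"])
    show "inj_on (\<lambda>(u, v). u + v) ((\<lambda>r. (f r, g r)) ` L)"
    proof (rule inj_onI, clarsimp)
      fix r s assume "r \<in> L" "s \<in> L" "f r + g r = f s + g s"
      with co[of r s] show "f r = f s \<and> g r = g s" by linarith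
    qed
    show "(\<lambda>(u, v). u + v) ` (\<lambda>r. (f r, g r)) ` L \<subseteq> {..<2 * T}"
      using bd by fastforce
  qed auto
  then show ?thesis by simp
qed

text \<open>Reversing the second coordinate, \<open>v\<close> to \<open>T - Suc v\<close>, turns a
  descending staircase into an ascending one.\<close>

lemma card_cells_antimonotone:
  fixes f g :: "'a \<Rightarrow> nat"
  assumes bd: "\<And>r. r \<in> L \<Longrightarrow> f r < T \<and> g r < T"
    and co: "\<And>r s. r \<in> L \<Longrightarrow> s \<in> L \<Longrightarrow> (f r \<le> f s \<and> g s \<le> g r) \<or> (f s \<le> f r \<and> g r \<le> g s)"
  shows "card ((\<lambda>r. (f r, g r)) ` L) \<le> 2 * T"
proof -
  have "(\<lambda>r. (f r, g r)) ` L = (\<lambda>(u, v). (u, T - Suc v)) ` (\<lambda>r. (f r, T - Suc (g r))) ` L"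
    using bd by (force simp: image_image)
  moreover have "inj_on (\<lambda>(u, v). (u, T - Suc v)) ((\<lambda>r. (f r, T - Suc (g r))) ` L)"
  proof (rule inj_onI, clarsimp)
    fix r s assume "r \<in> L" "s \<in> L" "T - Suc (T - Suc (g r)) = T - Suc (T - Suc (g s))"
    with bd[of r] bd[of s] show "T - Suc (g r) = T - Suc (g s)" by linarith
  qed
  ultimately have "card ((\<lambda>r. (f r, g r)) ` L) = card ((\<lambda>r. (f r, T - Suc (g r))) ` L)"
    by (simp add: card_image)
  also have "\<dots> \<le> 2 * T"
  proof (rule card_cells_comonotone)
    show "f r < T \<and> T - Suc (g r) < T" if "r \<in> L" for r using bd[OF that] by linarith
    show "f r \<le> f s \<and> T - Suc (g r) \<le> T - Suc (g s) \<or> f s \<le> f r \<and> T - Suc (g s) \<le> T - Suc (g r)"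
      if "r \<in> L" "s \<in> L" for r s using co[OF that] by (auto intro: diff_le_mono2)
  qed
  finally show ?thesis .
qed

text \<open>A line is encoded as the pair of its slope and its intercept, so vertical lines are
  outside the encoding. Pairs of points on them are kept out by
  \<open>generic_pairs\<close>.\<close>

definition grid_line :: "real set \<Rightarrow> real \<times> real \<Rightarrow> (real \<times> real) set" where
  "grid_line B l = {r \<in> B \<times> B. snd r = fst l * fst r + snd l}"

definition line_through :: "real \<times> real \<Rightarrow> real \<times> real \<Rightarrow> real \<times> real" where
  "line_through p q = (let m = (snd p - snd q) / (fst p - fst q) in (m, snd q - m * fst q))"

definition generic_pairs :: "real set \<Rightarrow> ((real \<times> real) \<times> (real \<times> real)) set" where
  "generic_pairs B = {(p, q). p \<in> B \<times> B \<and> q \<in> B \<times> B \<and> fst p \<noteq> fst q \<and> snd p \<noteq> snd q}"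

lemma finite_grid_line: "finite B \<Longrightarrow> finite (grid_line B l)"
  by (simp add: grid_line_def)

lemma finite_generic_pairs: "finite B \<Longrightarrow> finite (generic_pairs B)"
  by (rule finite_subset[of _ "(B \<times> B) \<times> (B \<times> B)"]) (auto simp: generic_pairs_def)

lemma mem_line_through:
  assumes "(p, q) \<in> generic_pairs B"
  shows "p \<in> grid_line B (line_through p q)" "q \<in> grid_line B (line_through p q)"
    "fst (line_through p q) \<noteq> 0"
proof -
  have pq: "p \<in> B \<times> B" "q \<in> B \<times> B" "fst p \<noteq> fst q" "snd p \<noteq> snd q"
    using assms by (auto simp: generic_pairs_def)
  have "(snd p - snd q) / (fst p - fst q) * (fst p - fst q) = snd p - snd q" using pq by simp
  then show "p \<in> grid_line B (line_through p q)" using pq(1)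
    by (simp add: grid_line_def line_through_def Let_def right_diff_distrib)
  show "q \<in> grid_line B (line_through p q)" "fst (line_through p q) \<noteq> 0"
    using pq by (simp_all add: grid_line_def line_through_def Let_def)
qed

lemma line_through_unique:
  assumes "fst l \<noteq> 0" "r \<in> grid_line B l" "r' \<in> grid_line B l" "r \<noteq> r'"
  shows "line_through r r' = l"
proof -
  have "snd r = fst l * fst r + snd l" "snd r' = fst l * fst r' + snd l"
    using assms by (auto simp: grid_line_def)
  moreover from this have "fst r \<noteq> fst r'" using assms(4) by (auto simp: prod_eq_iff)
  moreover from calculation have "(snd r - snd r') / (fst r - fst r') = fst l"
    by (simp add: field_simps)
  ultimately show ?thesis by (simp add: line_through_def Let_def prod_eq_iff)
qed

lemma card_grid_line_le:
  assumes "finite B" shows "card (grid_line B l) \<le> card B"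
  by (rule card_inj_on_le[of fst]) (use assms in \<open>auto simp: grid_line_def inj_on_def\<close>)

text \<open>
  Cut the grid into about \<open>(k/8)\<^sup>2\<close> blocks of side \<open>w\<close>, about \<open>8n/k\<close>. A monotone line meets at most \<open>k/2\<close>
  blocks, so a line with \<open>k\<close> grid points has at least \<open>k/2\<close> pairs of points sharing a block, and each
  such pair determines the line.
\<close>

lemma rich_lines_bound:
  fixes B :: "real set" and k :: nat
  assumes "finite B" "k \<ge> 8" and L: "finite L"
    "\<And>l. l \<in> L \<Longrightarrow> fst l \<noteq> 0 \<and> k \<le> card (grid_line B l)"
  shows "card L * k ^ 3 \<le> 162 * card B ^ 4"
proof (cases "L = {}")
  case False
  define n where "n = card B"
  then obtain l0 where "l0 \<in> L" using False by auto
  then have kn: "k \<le> n" using L(2) card_grid_line_le[OF assms(1)] unfolding n_def by (meson order_trans)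
  \<comment> \<open>The \<open>+ 1\<close> yields \<open>8 * n < w * k\<close>, while
    \<open>k \<le> n\<close> keeps \<open>w * k \<le> 9 * n\<close>. The constant 162 in the
    conclusion is 2 * 9^2.\<close>
  define w where "w = 8 * n div k + 1"
  have wk: "w * k \<le> 9 * n"
    unfolding w_def using kn div_times_less_eq_dividend[of "8 * n" k]
    unfolding add_mult_distrib by linarith
  have wk': "8 * n < w * k"
    unfolding w_def using assms(2) dividend_less_div_times[of k "8 * n"] by simp
  obtain \<beta> where \<beta>: "mono_on B \<beta>" "\<And>b. b \<in> B \<Longrightarrow> \<beta> b * w < n" "\<And>t. card {b \<in> B. \<beta> b = t} \<le> w"
    using ex_blocks[OF assms(1), of w] unfolding n_def w_def by auto
  \<comment> \<open>Here \<open>k \<ge> 8\<close> absorbs the \<open>+ 1\<close>: since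
    \<open>4 * T \<le> k\<close>, the \<open>2 * T\<close> cells met by a line number at most k /
    2.\<close>
  define T where "T = k div 8 + 1"
  have T: "4 * T \<le> k" unfolding T_def using assms(2) by presburger
  have \<beta>T: "\<beta> b < T" if "b \<in> B" for b
  proof -
    have "\<beta> b * (8 * n) \<le> \<beta> b * (w * k)" using wk' by simp
    also have "\<dots> < n * k" using \<beta>(2)[OF that] assms(2) by (simp flip: mult.assoc)
    finally have "8 * \<beta> b < k" by (simp add: ac_simps)
    then show ?thesis unfolding T_def by presburger
  qed
  define h where "h r = (\<beta> (fst r), \<beta> (snd r))" for r
  define R where "R l = {(r, r'). r \<in> grid_line B l \<and> r' \<in> grid_line B l \<and> r \<noteq> r' \<and> h r = h r'}" for l
  define S where "S = {(r, r'). r \<in> B \<times> B \<and> r' \<in> B \<times> B \<and> h r = h r'}"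
  have finS: "finite S"
    by (rule finite_subset[of _ "(B \<times> B) \<times> (B \<times> B)"]) (use assms(1) in \<open>auto simp: S_def\<close>)
  have RS: "R l \<subseteq> S" for l by (auto simp: R_def S_def grid_line_def)
  have finR: "finite (R l)" for l using RS finS by (rule finite_subset)
  have R: "k \<le> 2 * card (R l)" if "l \<in> L" for l
  proof -
    have m: "fst l \<noteq> 0" "k \<le> card (grid_line B l)" using L(2) that by auto
    have le: "\<beta> b \<le> \<beta> c" if "b \<in> B" "c \<in> B" "b \<le> c" for b c
      using \<beta>(1) that by (auto simp: mono_on_def)
    have "card (h ` grid_line B l) \<le> 2 * T"
    proof (cases "fst l > 0")
      case True
      have ord: "snd r \<le> snd s" if "r \<in> grid_line B l" "s \<in> grid_line B l" "fst r \<le> fst s" for r s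
        using that True by (auto simp: grid_line_def)
      show ?thesis unfolding h_def
      proof (rule card_cells_comonotone)
        show "\<beta> (fst r) < T \<and> \<beta> (snd r) < T" if "r \<in> grid_line B l" for r
          using that \<beta>T by (auto simp: grid_line_def)
        show "\<beta> (fst r) \<le> \<beta> (fst s) \<and> \<beta> (snd r) \<le> \<beta> (snd s) \<or>
            \<beta> (fst s) \<le> \<beta> (fst r) \<and> \<beta> (snd s) \<le> \<beta> (snd r)"
          if rs: "r \<in> grid_line B l" "s \<in> grid_line B l" for r s
        proof -
          have "fst r \<in> B" "snd r \<in> B" "fst s \<in> B" "snd s \<in> B" using rs by (auto simp: grid_line_def)
          then show ?thesis using le ord[OF rs] ord[OF rs(2,1)] by (metis linear)
        qed
      qed
    next
      case False
      then have neg: "fst l < 0" using m by simp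
      have ord: "snd s \<le> snd r" if "r \<in> grid_line B l" "s \<in> grid_line B l" "fst r \<le> fst s" for r s
        using that neg by (auto simp: grid_line_def)
      show ?thesis unfolding h_def
      proof (rule card_cells_antimonotone)
        show "\<beta> (fst r) < T \<and> \<beta> (snd r) < T" if "r \<in> grid_line B l" for r
          using that \<beta>T by (auto simp: grid_line_def)
        show "\<beta> (fst r) \<le> \<beta> (fst s) \<and> \<beta> (snd s) \<le> \<beta> (snd r) \<or>
            \<beta> (fst s) \<le> \<beta> (fst r) \<and> \<beta> (snd r) \<le> \<beta> (snd s)"
          if rs: "r \<in> grid_line B l" "s \<in> grid_line B l" for r s
        proof -
          have "fst r \<in> B" "snd r \<in> B" "fst s \<in> B" "snd s \<in> B" using rs by (auto simp: grid_line_def)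
          then show ?thesis using le ord[OF rs] ord[OF rs(2,1)] by (metis linear)
        qed
      qed
    qed
    then show ?thesis
      using card_collisions_ge[OF finite_grid_line[OF assms(1)], of l h] m(2) T
      unfolding R_def by linarith
  qed
  have disj: "R l \<inter> R l' = {}" if "l \<in> L" "l' \<in> L" "l \<noteq> l'" for l l'
  proof -
    have "line_through r r' = l" if "(r, r') \<in> R l" "l \<in> L" for r r' l
      using that L(2) by (intro line_through_unique[of _ _ B]) (auto simp: R_def)
    then have "l = l'" if "e \<in> R l" "e \<in> R l'" for e
      using that \<open>l \<in> L\<close> \<open>l' \<in> L\<close> by (metis surj_pair)
    then show ?thesis using \<open>l \<noteq> l'\<close> by blast
  qed
  have "card L * k = (\<Sum>l\<in>L. k)" by simp
  also have "\<dots> \<le> (\<Sum>l\<in>L. 2 * card (R l))" by (intro sum_mono R)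
  also have "\<dots> = 2 * card (\<Union>l\<in>L. R l)"
    using L(1) finR disj by (subst card_UN_disjoint) (auto simp: sum_distrib_left)
  also have "\<dots> \<le> 2 * card S" using finS RS by (intro mult_le_mono2 card_mono) auto
  also have "card S \<le> card (fst ` S) * (w * w)"
  proof (rule card_le_fibers[OF finS])
    fix r
    let ?C = "\<lambda>t. {b \<in> B. \<beta> b = t}"
    have "{x \<in> S. fst x = r} \<subseteq> {r} \<times> (?C (\<beta> (fst r)) \<times> ?C (\<beta> (snd r)))"
      by (auto simp: S_def h_def)
    then have "card {x \<in> S. fst x = r} \<le> card ({r} \<times> (?C (\<beta> (fst r)) \<times> ?C (\<beta> (snd r))))"
      using assms(1) by (intro card_mono) auto
    also have "\<dots> \<le> w * w" using \<beta>(3) by (simp add: card_cartesian_product mult_le_mono)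
    finally show "card {x \<in> S. fst x = r} \<le> w * w" .
  qed
  also have "card (fst ` S) \<le> card (B \<times> B)"
    using assms(1) by (intro card_mono) (auto simp: S_def)
  also have "card (B \<times> B) = n * n" by (simp add: card_cartesian_product n_def)
  finally have "card L * k \<le> 2 * (n * n * (w * w))" by simp
  then have "card L * k * (k * k) \<le> 2 * (n * n * (w * w)) * (k * k)" by (rule mult_le_mono1)
  also have "\<dots> = 2 * (n * n) * ((w * k) * (w * k))" by (simp add: ac_simps)
  also have "\<dots> \<le> 2 * (n * n) * ((9 * n) * (9 * n))" by (intro mult_le_mono wk) auto
  finally show ?thesis unfolding n_def[symmetric] by (simp add: eval_nat_numeral algebra_simps)
qed simp

text \<open>At most 162 n^4 / k^3 lines are involved, and each carries at most (2k)^2 ordered pairs;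
  648 is 4 * 162. The resulting decay like 1 / k makes the sum over dyadic scales converge.\<close>

lemma rich_pairs_dyadic:
  fixes B :: "real set" and k :: nat
  assumes "finite B" "k \<ge> 8"
  shows "card {(p, q) \<in> generic_pairs B. card (grid_line B (line_through p q)) \<in> {k..<2 * k}} * k
    \<le> 648 * card B ^ 4" (is "card ?E * k \<le> _")
proof -
  let ?f = "\<lambda>(p, q). line_through p q"
  have fin: "finite ?E" by (rule finite_subset[OF _ finite_generic_pairs[OF assms(1)]]) auto
  have "card ?E \<le> card (?f ` ?E) * (2 * k * (2 * k))"
  proof (rule card_le_fibers[OF fin])
    fix l assume "l \<in> ?f ` ?E"
    then have l: "card (grid_line B l) \<le> 2 * k" by auto
    have "card {x \<in> ?E. ?f x = l} \<le> card (grid_line B l \<times> grid_line B l)"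
      using finite_grid_line[OF assms(1)] by (intro card_mono) (auto dest: mem_line_through)
    also have "\<dots> \<le> 2 * k * (2 * k)" unfolding card_cartesian_product by (intro mult_le_mono l)
    finally show "card {x \<in> ?E. ?f x = l} \<le> 2 * k * (2 * k)" .
  qed
  then have "card ?E * k \<le> card (?f ` ?E) * (2 * k * (2 * k)) * k" by (rule mult_le_mono1)
  also have "\<dots> = 4 * (card (?f ` ?E) * k ^ 3)"
    unfolding power3_eq_cube by (simp only: ac_simps)
  also have "\<dots> \<le> 4 * (162 * card B ^ 4)"
    using assms fin by (intro mult_le_mono2 rich_lines_bound) (auto dest: mem_line_through)
  finally show ?thesis by simp
qed

lemma card_generic_pairs_ge:
  assumes "finite B" shows "(card B * (card B - 1)) ^ 2 \<le> card (generic_pairs B)"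
proof -
  let ?D = "SIGMA a:B. B - {a}"
  have "card ?D = (\<Sum>a\<in>B. card (B - {a}))" using assms by (subst card_SigmaI) auto
  also have "\<dots> = (\<Sum>a\<in>B. card B - 1)" by (intro sum.cong) (auto simp: card_Diff_singleton)
  finally have D: "card ?D = card B * (card B - 1)" by simp
  have "card (?D \<times> ?D) \<le> card (generic_pairs B)"
    by (rule card_inj_on_le[of "\<lambda>((a, c), (b, d)). ((a, b), (c, d))"])
      (auto simp: inj_on_def generic_pairs_def intro: finite_generic_pairs[OF assms, unfolded generic_pairs_def])
  then show ?thesis by (simp only: card_cartesian_product D power2_eq_square)
qed

lemma sum_inverse_power2_le: "(\<Sum>i<N. 1 / 2 ^ (i + a)) \<le> (2::real) / 2 ^ a"
proof -
  have "(\<Sum>i<N. 1 / 2 ^ (i + a)) = (2 - 2 / 2 ^ N) / (2::real) ^ a"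
    by (induction N) (auto simp: field_simps power_add)
  also have "\<dots> \<le> 2 / 2 ^ a" by (intro divide_right_mono) auto
  finally show ?thesis .
qed

text \<open>There are at least n^4 / 4 generic pairs. Summing the dyadic bounds from 2^14 upwards
  removes at most 648 * 2 / 2^14 < 1/8 of n^4, which fixes the threshold 2^14.\<close>

lemma poor_pairs:
  assumes "finite B" "card B \<ge> 2"
  shows "real (card {(p, q) \<in> generic_pairs B. card (grid_line B (line_through p q)) < 2 ^ 14})
    \<ge> real (card B) ^ 4 / 8" (is "real (card ?P) \<ge> _")
proof -
  let ?n = "card B"
  let ?r = "\<lambda>p q. card (grid_line B (line_through p q))"
  let ?E = "\<lambda>i. {(p, q) \<in> generic_pairs B. ?r p q \<in> {2 ^ (i + 14)..<2 * 2 ^ (i + 14)}}"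
  note fin = finite_generic_pairs[OF assms(1)]
  have finE: "finite (?E i)" for i by (rule finite_subset[OF _ fin]) auto
  have finP: "finite ?P" by (rule finite_subset[OF _ fin]) auto
  \<comment> \<open>The range \<open>i < ?n\<close> reaches all scales, because a line has at most
    \<open>?n\<close> grid points and \<open>2 ^ m \<le> ?n\<close> forces
    \<open>m < ?n\<close>.\<close>
  have "generic_pairs B \<subseteq> ?P \<union> (\<Union>i<?n. ?E i)"
  proof (rule subsetI, clarify)
    fix p q assume pq: "(p, q) \<in> generic_pairs B"
      and no: "(p, q) \<notin> (\<Union>i<?n. ?E i)"
    show "?r p q < 2 ^ 14"
    proof (rule ccontr)
      assume "\<not> ?r p q < 2 ^ 14"
      then have big: "2 ^ 14 \<le> ?r p q" by simp
      then obtain m where m: "2 ^ m \<le> ?r p q" "?r p q < 2 ^ (m + 1)"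
        using ex_power_ivl1[of 2 "?r p q"] by auto
      have "(2::nat) ^ 14 < 2 ^ (m + 1)" using big m(2) by (rule le_less_trans)
      then have "14 \<le> m" by (metis Suc_eq_plus1 less_Suc_eq_le one_less_numeral_iff power_less_imp_less_exp semiring_norm(76))
      moreover have "m < ?n"
        using m(1) card_grid_line_le[OF assms(1), of "line_through p q"] less_exp[of m] by linarith
      ultimately have "m - 14 < ?n" "(p, q) \<in> ?E (m - 14)" using pq m by auto
      then show False using no by blast
    qed
  qed
  then have "card (generic_pairs B) \<le> card (?P \<union> (\<Union>i<?n. ?E i))"
    using finE finP by (intro card_mono) auto
  also have "\<dots> \<le> card ?P + card (\<Union>i<?n. ?E i)" by (rule card_Un_le)
  also have "card (\<Union>i<?n. ?E i) \<le> (\<Sum>i<?n. card (?E i))" by (intro card_UN_le) auto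
  finally have "real (card (generic_pairs B)) \<le> real (card ?P) + (\<Sum>i<?n. real (card (?E i)))"
    by (simp flip: of_nat_sum of_nat_add)
  moreover have "(\<Sum>i<?n. real (card (?E i))) \<le> (\<Sum>i<?n. 648 * real ?n ^ 4 * (1 / 2 ^ (i + 14)))"
  proof (rule sum_mono)
    fix i
    have "(2::nat) ^ (i + 14) \<ge> 2 ^ 3" by (intro power_increasing) auto
    then have "card (?E i) * 2 ^ (i + 14) \<le> 648 * ?n ^ 4"
      by (intro rich_pairs_dyadic[OF assms(1)]) simp
    then have "real (card (?E i) * 2 ^ (i + 14)) \<le> real (648 * ?n ^ 4)" by (rule of_nat_mono)
    then show "real (card (?E i)) \<le> 648 * real ?n ^ 4 * (1 / 2 ^ (i + 14))"
      by (simp add: pos_le_divide_eq)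
  qed
  moreover have "(\<Sum>i<?n. 648 * real ?n ^ 4 * (1 / 2 ^ (i + 14))) \<le> 648 * real ?n ^ 4 * (2 / 2 ^ 14)"
    unfolding sum_distrib_left[symmetric]
    by (intro mult_left_mono sum_inverse_power2_le) auto
  moreover have "real (card (generic_pairs B)) \<ge> real ?n ^ 4 / 4"
  proof -
    have "real ?n ^ 4 / 4 = (real ?n * (real ?n / 2)) ^ 2"
      by (simp add: eval_nat_numeral)
    also have "\<dots> \<le> (real ?n * (real ?n - 1)) ^ 2"
      using assms(2) by (intro power_mono mult_left_mono) auto
    also have "\<dots> = real ((?n * (?n - 1)) ^ 2)"
      using assms by (simp add: of_nat_diff)
    also have "\<dots> \<le> real (card (generic_pairs B))"
      by (intro of_nat_mono card_generic_pairs_ge[OF assms(1)])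
    finally show ?thesis .
  qed
  moreover have "648 * real ?n ^ 4 * (2 / 2 ^ 14) \<le> real ?n ^ 4 / 8" by simp
  ultimately show ?thesis by linarith
qed

text \<open>By pigeonhole some \<open>q\<close> is the second point of at least n^2 / 8 poor pairs.
  Points seen from \<open>q\<close> with the same slope lie on one poor line, so a slope is used
  fewer than 2^14 times; 2^17 is 8 * 2^14.\<close>

lemma ex_many_slopes:
  fixes B :: "real set"
  assumes "finite B" "card B \<ge> 2"
  obtains x y where "x \<in> B" "y \<in> B"
    "real (card {(c - y) / (b - x) | b c. b \<in> B \<and> c \<in> B \<and> b \<noteq> x}) \<ge> real (card B) ^ 2 / 2 ^ 17"
proof -
  let ?n = "card B"
  define P where "P = {(p, q) \<in> generic_pairs B. card (grid_line B (line_through p q)) < 2 ^ 14}"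
  have P: "(p, q) \<in> generic_pairs B" "card (grid_line B (line_through p q)) < 2 ^ 14"
    if "(p, q) \<in> P" for p q using that by (simp_all add: P_def)
  have PB: "q \<in> B \<times> B" "fst p \<in> B" "snd p \<in> B" "fst p \<noteq> fst q" if "(p, q) \<in> P" for p q
    using P(1)[OF that] by (auto simp: generic_pairs_def)
  have finP: "finite P" by (rule finite_subset[OF _ finite_generic_pairs[OF assms(1)]]) (auto dest: P)
  have "\<exists>q \<in> B \<times> B. real (card {e \<in> P. snd e = q}) \<ge> real ?n ^ 2 / 8"
  proof (rule ccontr)
    assume "\<not> ?thesis"
    then have lt: "real (card {e \<in> P. snd e = q}) < real ?n ^ 2 / 8" if "q \<in> B \<times> B" for q
      using that by (meson not_le_imp_less)
    have "P \<subseteq> (\<Union>q\<in>B \<times> B. {e \<in> P. snd e = q})"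
      using PB(1) by force
    then have "card P \<le> card (\<Union>q\<in>B \<times> B. {e \<in> P. snd e = q})"
      using finP assms(1) by (intro card_mono) auto
    also have "\<dots> \<le> (\<Sum>q\<in>B \<times> B. card {e \<in> P. snd e = q})"
      using assms(1) by (intro card_UN_le) auto
    finally have "real (card P) \<le> (\<Sum>q\<in>B \<times> B. real (card {e \<in> P. snd e = q}))"
      by (simp flip: of_nat_sum)
    also have "\<dots> < (\<Sum>q\<in>B \<times> B. real ?n ^ 2 / 8)"
      using lt assms by (intro sum_strict_mono) (auto simp: card_gt_0_iff)
    also have "\<dots> = real ?n ^ 4 / 8" by (simp add: card_cartesian_product eval_nat_numeral)
    finally show False using poor_pairs[OF assms] unfolding P_def by linarith
  qed
  then obtain q where q: "q \<in> B \<times> B" "real (card {e \<in> P. snd e = q}) \<ge> real ?n ^ 2 / 8" by blast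
  let ?Q = "{e \<in> P. snd e = q}"
  let ?f = "\<lambda>e. (snd (fst e) - snd q) / (fst (fst e) - fst q)"
  have finQ: "finite ?Q" using finP by simp
  have "card ?Q \<le> card (?f ` ?Q) * 2 ^ 14"
  proof (rule card_le_fibers[OF finQ])
    fix s assume "s \<in> ?f ` ?Q"
    then obtain p0 where p0: "(p0, q) \<in> P" "s = ?f (p0, q)" by force
    let ?l = "line_through p0 q"
    have "p \<in> grid_line B ?l" if "(p, q) \<in> P" "?f (p, q) = s" for p
    proof -
      have "line_through p q = ?l" using that p0 by (simp add: line_through_def)
      then show ?thesis using mem_line_through(1)[OF P(1)[OF that(1)]] by simp
    qed
    then have "{x \<in> ?Q. ?f x = s} \<subseteq> (\<lambda>p. (p, q)) ` grid_line B ?l" by force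
    then have "card {x \<in> ?Q. ?f x = s} \<le> card ((\<lambda>p. (p, q)) ` grid_line B ?l)"
      using finite_grid_line[OF assms(1)] by (intro card_mono) auto
    also have "\<dots> \<le> card (grid_line B ?l)" using finite_grid_line[OF assms(1)] by (rule card_image_le)
    also have "\<dots> \<le> 2 ^ 14" using P(2)[OF p0(1)] by simp
    finally show "card {x \<in> ?Q. ?f x = s} \<le> 2 ^ 14" .
  qed
  moreover let ?S = "{(c - snd q) / (b - fst q) | b c. b \<in> B \<and> c \<in> B \<and> b \<noteq> fst q}"
  have finS: "finite ?S"
    by (rule finite_subset[of _ "(\<lambda>(b, c). (c - snd q) / (b - fst q)) ` (B \<times> B)"])
      (use assms(1) in auto)
  have "?f ` ?Q \<subseteq> ?S"
  proof (rule image_subsetI)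
    fix e assume "e \<in> ?Q"
    then have "(fst e, q) \<in> P" by auto
    from PB[OF this] show "?f e \<in> ?S" by auto
  qed
  then have "card (?f ` ?Q) \<le> card ?S" using finS by (rule card_mono[rotated])
  ultimately have "card ?Q \<le> card ?S * 2 ^ 14" by (meson mult_le_mono1 order_trans)
  then have "real (card ?Q) \<le> real (card ?S * 2 ^ 14)" by (rule of_nat_mono)
  then have "real (card ?S) \<ge> real ?n ^ 2 / 2 ^ 17" using q(2) by simp
  then show thesis using that[of "fst q" "snd q"] q(1) by auto
qed

section \<open>Squeezing\<close>

text \<open>The pair of ranks determines \<open>k\<close>, so at most s^2, hence at most half, of
  the elements have both ranks at most \<open>s\<close>. Each of the others contributes more than
  \<open>s\<close> to the total.\<close>

lemma sum_ranks_ge: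
  fixes f g :: "'a \<Rightarrow> real"
  assumes "finite K" "inj_on (\<lambda>k. (f k, g k)) K" "2 * (s * s) \<le> card K"
  shows "card K * s \<le> 2 * ((\<Sum>k\<in>K. card {r \<in> f ` K. r \<le> f k}) + (\<Sum>k\<in>K. card {r \<in> g ` K. r \<le> g k}))"
proof -
  define rk where "rk h k = card {r \<in> h ` K. r \<le> h k}" for h :: "'a \<Rightarrow> real" and k
  have pos: "rk h k > 0" if "k \<in> K" for h k
    unfolding rk_def using assms(1) that by (auto simp: card_gt_0_iff)
  have less: "rk h k < rk h l" if "k \<in> K" "l \<in> K" "h k < h l" for h k l
    unfolding rk_def using assms(1) that by (intro psubset_card_mono) force+
  have eq: "h k = h l" if "k \<in> K" "l \<in> K" "rk h k = rk h l" for h k l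
    using less[of k l h] less[of l k h] that by (metis less_irrefl linorder_neqE_linordered_idom)
  define A where "A = {k \<in> K. rk f k \<le> s \<and> rk g k \<le> s}"
  have "card A \<le> card ({0<..s} \<times> {0<..s})"
  proof (rule card_inj_on_le[of "\<lambda>k. (rk f k, rk g k)"])
    show "inj_on (\<lambda>k. (rk f k, rk g k)) A"
    proof (rule inj_onI)
      fix k l assume "k \<in> A" "l \<in> A" "(rk f k, rk g k) = (rk f l, rk g l)"
      then have "k \<in> K" "l \<in> K" "(f k, g k) = (f l, g l)" using eq by (auto simp: A_def)
      then show "k = l" using assms(2) by (auto dest: inj_onD)
    qed
    show "(\<lambda>k. (rk f k, rk g k)) ` A \<subseteq> {0<..s} \<times> {0<..s}" using pos by (auto simp: A_def)
  qed auto
  then have "card A \<le> s * s" by (simp add: card_cartesian_product)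
  moreover have "card (K - A) = card K - card A"
    using assms(1) by (intro card_Diff_subset) (auto simp: A_def)
  ultimately have "card K \<le> 2 * card (K - A)" using assms(3) by linarith
  then have "card K * s \<le> 2 * (card (K - A) * s)" by (simp flip: mult.assoc)
  also have "card (K - A) * s = (\<Sum>k\<in>K - A. s)" by simp
  also have "\<dots> \<le> (\<Sum>k\<in>K - A. rk f k + rk g k)" by (intro sum_mono) (auto simp: A_def)
  also have "\<dots> \<le> (\<Sum>k\<in>K. rk f k + rk g k)" using assms(1) by (intro sum_mono2) auto
  finally show ?thesis by (simp add: sum.distrib rk_def)
qed

section \<open>The angle at the origin between \<open>(p, t)\<close> and \<open>(q, t)\<close>, as a
  function of \<open>t\<close>\<close>

definition arctan_gap :: "real \<Rightarrow> real \<Rightarrow> real \<Rightarrow> real" where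
  "arctan_gap p q t = arctan (t / p) - arctan (t / q)"

text \<open>The derivative in \<open>t\<close> for positive \<open>p\<close> and \<open>q\<close>,
  over a common denominator, so that its sign is readable and quotients of two such derivatives
  factor.\<close>

definition arctan_gap' :: "real \<Rightarrow> real \<Rightarrow> real \<Rightarrow> real" where
  "arctan_gap' p q t = (q - p) * (p * q - t\<^sup>2) / ((p\<^sup>2 + t\<^sup>2) * (q\<^sup>2 + t\<^sup>2))"

lemma has_derivative_arctan_gap:
  assumes "0 < p" "0 < q"
  shows "(arctan_gap p q has_real_derivative arctan_gap' p q t) (at t)"
proof -
  have *: "((\<lambda>t. arctan (t / p)) has_real_derivative p / (p\<^sup>2 + t\<^sup>2)) (at t)" if "0 < p" for p
  proof -
    have "inverse (1 + (t / p)\<^sup>2) * (1 / p) = p / (p\<^sup>2 + t\<^sup>2)"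
      using that by (simp add: divide_simps power2_eq_square)
    moreover have "((\<lambda>t. arctan (t / p)) has_real_derivative inverse (1 + (t / p)\<^sup>2) * (1 / p)) (at t)"
      using that by (auto intro!: derivative_eq_intros)
    ultimately show ?thesis by simp
  qed
  have "p\<^sup>2 + t\<^sup>2 \<noteq> 0" "q\<^sup>2 + t\<^sup>2 \<noteq> 0" using assms by (auto simp: sum_power2_eq_zero_iff)
  then have "p / (p\<^sup>2 + t\<^sup>2) - q / (q\<^sup>2 + t\<^sup>2) = arctan_gap' p q t"
    by (simp add: arctan_gap'_def diff_frac_eq) (simp add: algebra_simps power2_eq_square)
  then show ?thesis unfolding arctan_gap_def
    using DERIV_diff[OF *[OF assms(1)] *[OF assms(2)]] by simp
qed

text \<open>For \<open>p < q\<close> the sign is that of \<open>p * q - t\<^sup>2\<close>, and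
  \<open>t \<le> p\<close> makes it positive. This is why squeezing asks that every
  \<open>y i\<close> be at most every \<open>x j\<close>.\<close>

lemma arctan_gap'_pos:
  assumes "0 < p" "p < q" "0 \<le> t" "t \<le> p"
  shows "0 < arctan_gap' p q t"
proof -
  have "t\<^sup>2 \<le> p * p" using assms by (simp add: power2_eq_square mult_mono)
  also have "\<dots> < p * q" using assms by simp
  finally show ?thesis unfolding arctan_gap'_def using assms
    by (intro divide_pos_pos mult_pos_pos add_pos_nonneg) auto
qed

lemma arctan_gap_strict_mono:
  assumes "0 < p" "p < q" "0 \<le> s" "s < t" "t \<le> p"
  shows "arctan_gap p q s < arctan_gap p q t"
proof (rule DERIV_pos_imp_increasing[OF assms(4)])
  fix z assume "s \<le> z" "z \<le> t"
  then show "\<exists>y. DERIV (arctan_gap p q) z :> y \<and> 0 < y"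
    using assms by (intro exI[of _ "arctan_gap' p q z"] conjI has_derivative_arctan_gap arctan_gap'_pos) auto
qed

lemma ratio_strict_antimono:
  fixes u v :: real
  assumes "0 < u" "u \<le> v" "s < t" "0 \<le> s"
  shows "(v + t) / (u + t) \<le> (v + s) / (u + s)"
    and "t < u \<Longrightarrow> u < v \<Longrightarrow> (u - t) / (v - t) < (u - s) / (v - s)"
proof -
  have "u * (t - s) \<le> v * (t - s)" using assms by (intro mult_right_mono) auto
  then have "(v + t) * (u + s) \<le> (v + s) * (u + t)" by (simp add: algebra_simps)
  then show "(v + t) / (u + t) \<le> (v + s) / (u + s)" using assms by (simp add: frac_le_eq divide_simps mult.commute)
  assume *: "t < u" "u < v"
  then have "u * (t - s) < v * (t - s)" using assms by (intro mult_strict_right_mono) auto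
  then have "(u - t) * (v - s) < (u - s) * (v - t)" by (simp add: algebra_simps)
  then show "(u - t) / (v - t) < (u - s) / (v - s)" using assms * by (simp add: divide_simps)
qed

text \<open>
  The ratio of the two derivatives is, up to a constant, a product of the decreasing factors
  \<open>(ab - t\<^sup>2) / (cd - t\<^sup>2)\<close>, \<open>(c\<^sup>2 + t\<^sup>2) / (a\<^sup>2 + t\<^sup>2)\<close> and \<open>(d\<^sup>2 + t\<^sup>2) / (b\<^sup>2 + t\<^sup>2)\<close>.
\<close>

lemma arctan_gap'_ratio:
  assumes "0 < a" "a < b" "b \<le> c" "c < d" "0 \<le> s" "s < t" "t \<le> a"
  shows "arctan_gap' a b t * arctan_gap' c d s < arctan_gap' a b s * arctan_gap' c d t"
proof -
  \<comment> \<open>The argument of \<open>Q\<close> stands for the square of the variable, so each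
    factor is a quotient of linear functions, to which \<open>ratio_strict_antimono\<close> applies.
    Strictness is taken from the first factor.\<close>
  define Q where "Q t = ((a * b - t) / (c * d - t)) * ((c\<^sup>2 + t) / (a\<^sup>2 + t)) * ((d\<^sup>2 + t) / (b\<^sup>2 + t))" for t
  have st: "s\<^sup>2 < t\<^sup>2" using assms by (intro power_strict_mono) auto
  have "t\<^sup>2 \<le> a * a" using assms by (simp add: power2_eq_square mult_mono)
  also have "\<dots> < a * b" using assms by simp
  finally have tab: "t\<^sup>2 < a * b" .
  have abcd: "a * b < c * d" using assms by (intro mult_strict_mono') auto
  have sq: "a\<^sup>2 \<le> c\<^sup>2" "b\<^sup>2 \<le> d\<^sup>2" "0 < a\<^sup>2" "0 < b\<^sup>2" using assms by (auto intro!: power_mono)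
  have R: "arctan_gap' a b z = (b - a) / (d - c) * Q (z\<^sup>2) * arctan_gap' c d z" if "0 \<le> z" "z \<le> t" for z
  proof -
    have "z\<^sup>2 \<le> t\<^sup>2" using that by (intro power_mono) auto
    then have "c * d - z\<^sup>2 > 0" using tab abcd by linarith
    moreover have "c\<^sup>2 + z\<^sup>2 > 0" "d\<^sup>2 + z\<^sup>2 > 0" "a\<^sup>2 + z\<^sup>2 > 0" "b\<^sup>2 + z\<^sup>2 > 0"
      using assms by (auto intro!: add_pos_nonneg)
    ultimately show ?thesis
      unfolding arctan_gap'_def Q_def using assms by (simp add: divide_simps)
  qed
  have "Q (t\<^sup>2) < Q (s\<^sup>2)" unfolding Q_def
  proof (intro mult_less_le_imp_less)
    show "(a * b - t\<^sup>2) / (c * d - t\<^sup>2) < (a * b - s\<^sup>2) / (c * d - s\<^sup>2)"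
      using assms st tab abcd by (intro ratio_strict_antimono) auto
    show "(c\<^sup>2 + t\<^sup>2) / (a\<^sup>2 + t\<^sup>2) \<le> (c\<^sup>2 + s\<^sup>2) / (a\<^sup>2 + s\<^sup>2)"
      "(d\<^sup>2 + t\<^sup>2) / (b\<^sup>2 + t\<^sup>2) \<le> (d\<^sup>2 + s\<^sup>2) / (b\<^sup>2 + s\<^sup>2)"
      using sq st by (auto intro!: ratio_strict_antimono(1))
    show "0 \<le> (a * b - t\<^sup>2) / (c * d - t\<^sup>2)" "0 < (c\<^sup>2 + t\<^sup>2) / (a\<^sup>2 + t\<^sup>2)"
      "0 < (d\<^sup>2 + t\<^sup>2) / (b\<^sup>2 + t\<^sup>2)"
      "0 \<le> (a * b - t\<^sup>2) / (c * d - t\<^sup>2) * ((c\<^sup>2 + t\<^sup>2) / (a\<^sup>2 + t\<^sup>2))"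
      using tab abcd sq by (auto intro!: divide_pos_pos add_pos_nonneg mult_nonneg_nonneg divide_nonneg_nonneg)
  qed
  then have "(b - a) / (d - c) * Q (t\<^sup>2) < (b - a) / (d - c) * Q (s\<^sup>2)"
    using assms by (intro mult_strict_left_mono) auto
  moreover have "0 < arctan_gap' c d s * arctan_gap' c d t"
    using assms by (intro mult_pos_pos arctan_gap'_pos) auto
  ultimately have "(b - a) / (d - c) * Q (t\<^sup>2) * (arctan_gap' c d s * arctan_gap' c d t)
      < (b - a) / (d - c) * Q (s\<^sup>2) * (arctan_gap' c d s * arctan_gap' c d t)"
    by (rule mult_strict_right_mono)
  then show ?thesis using R[of s] R[of t] assms by (simp add: ac_simps)
qed

text \<open>By Cauchy's mean value theorem the quotient of the two increments over an interval
  equals the quotient of the derivatives at an interior point. If both increments agreed over two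
  successive intervals, the quotient of derivatives would take the same value at two different
  points, against its strict monotonicity.\<close>

lemma arctan_gap_increments_distinct:
  assumes "0 < a" "a < b" "b \<le> c" "c < d" "0 \<le> s" "s < s'" "s' \<le> t" "t < t'" "t' \<le> a"
    and eq: "arctan_gap a b s' - arctan_gap a b s = arctan_gap a b t' - arctan_gap a b t"
  shows "arctan_gap c d s' - arctan_gap c d s \<noteq> arctan_gap c d t' - arctan_gap c d t"
proof
  assume eq': "arctan_gap c d s' - arctan_gap c d s = arctan_gap c d t' - arctan_gap c d t"
  have cauchy: "\<exists>z. u < z \<and> z < v \<and> (arctan_gap a b v - arctan_gap a b u) * arctan_gap' c d z =
      (arctan_gap c d v - arctan_gap c d u) * arctan_gap' a b z" if "u < v" for u v
  proof -
    have "DERIV (arctan_gap a b) z :> arctan_gap' a b z" "DERIV (arctan_gap c d) z :> arctan_gap' c d z" for z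
      using assms by (auto intro: has_derivative_arctan_gap)
    then show ?thesis
      using GMVT'[OF that, of "arctan_gap a b" "arctan_gap c d" "arctan_gap' c d" "arctan_gap' a b"]
      by (auto intro: DERIV_isCont)
  qed
  let ?F = "arctan_gap a b s' - arctan_gap a b s"
  let ?G = "arctan_gap c d s' - arctan_gap c d s"
  obtain y where y: "s < y" "y < s'" "?F * arctan_gap' c d y = ?G * arctan_gap' a b y"
    using cauchy[OF assms(6)] by blast
  obtain z where z: "t < z" "z < t'" "?F * arctan_gap' c d z = ?G * arctan_gap' a b z"
    using cauchy[OF assms(8)] unfolding eq eq' by blast
  have pos: "0 < ?F" "0 < ?G"
    using assms arctan_gap_strict_mono[of a b s s'] arctan_gap_strict_mono[of c d s s'] by auto
  have "?F * ?G * (arctan_gap' a b y * arctan_gap' c d z) = (?F * arctan_gap' c d z) * (?G * arctan_gap' a b y)"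
    by (simp add: ac_simps)
  also have "\<dots> = ?F * ?G * (arctan_gap' a b z * arctan_gap' c d y)"
    unfolding z(3) y(3)[symmetric] by (simp add: ac_simps)
  finally have "arctan_gap' a b y * arctan_gap' c d z = arctan_gap' a b z * arctan_gap' c d y"
    using pos by simp
  moreover have "arctan_gap' a b z * arctan_gap' c d y < arctan_gap' a b y * arctan_gap' c d z"
    using assms y z by (intro arctan_gap'_ratio) auto
  ultimately show False by simp
qed

text \<open>
  Put \<open>g\<^sub>i(t) = arctan (t / x\<^sub>i) - arctan (t / x\<^sub>i\<^sub>+\<^sub>1)\<close>, which increases up to \<open>t = Y = max y\<close>. Between
  consecutive values \<open>arctan (Y / x\<^sub>j)\<close> there is room for all \<open>g\<^sub>i(y\<^sub>k)\<close> when \<open>g\<^sub>i(Y) \<le> g\<^sub>j(Y)\<close>, and between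
  \<open>g\<^sub>i(y\<^sub>k)\<close> and \<open>g\<^sub>i(y\<^sub>k\<^sub>+\<^sub>1)\<close> there is room for all increments of \<open>g\<^sub>i\<close> that do not exceed this one. By
  \<open>arctan_gap_increments_distinct\<close> and \<open>sum_ranks_ge\<close>, at least one of the two indices \<open>i\<close> with the
  smallest gaps has enough distinct increments.
\<close>

lemma squeezing_enumerated:
  fixes x y :: "nat \<Rightarrow> real"
  assumes m: "m \<ge> 3" "2 * (s * s) \<le> m - 1"
    and x: "strict_mono_on {..<m} x" and y: "strict_mono_on {..<m} y"
    and ypos: "\<And>i. i < m \<Longrightarrow> 0 < y i"
    and le: "\<And>i j. i < m \<Longrightarrow> j < m \<Longrightarrow> y i \<le> x j"
    and T: "\<And>i j. i < m \<Longrightarrow> j < m \<Longrightarrow> arctan (y i / x j) \<in> T"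
    and finT: "finite T"
  shows "(m - 2) * ((m - 1) * s) \<le>
    4 * card (sums_4_3 T)" (is "_ \<le> 4 * card ?S")
proof -
  define g where "g j = arctan_gap (x j) (x (Suc j))" for j
  define \<rho> where "\<rho> j k = g j (y (Suc k)) - g j (y k)" for j k
  define Y where "Y = y (m - 1)"
  define \<theta> where "\<theta> j = arctan (Y / x j)" for j
  define J where "J = {..<m - 1}"
  have J: "finite J" "card J = m - 1" by (simp_all add: J_def)
  have Jm: "j < m" "Suc j < m" if "j \<in> J" for j using that by (auto simp: J_def)
  have xless: "x i < x j" if "i < j" "j < m" for i j using x that by (auto simp: strict_mono_on_def)
  have yless: "y i < y j" if "i < j" "j < m" for i j using y that by (auto simp: strict_mono_on_def)
  have yle: "y i \<le> y j" if "i \<le> j" "j < m" for i j using yless[of i j] that by (cases "i = j") auto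
  have xle: "x i \<le> x j" if "i \<le> j" "j < m" for i j using xless[of i j] that by (cases "i = j") auto
  have xpos: "0 < x j" if "j < m" for j using le[OF that that] ypos[OF that] by linarith
  have Y: "0 < Y" "y i \<le> Y" if "i < m" for i using ypos[of "m - 1"] yle[of i "m - 1"] that m by (auto simp: Y_def)
  have gmono: "g j s < g j t" if "j \<in> J" "0 \<le> s" "s < t" "t \<le> x j" for j s t
    unfolding g_def using that Jm[OF that(1)] xpos xless by (intro arctan_gap_strict_mono) auto
  have gy: "g j (y k) < g j (y l)" if "j \<in> J" "k < l" "l < m" for j k l
    using that Jm[OF that(1)] ypos[of k] yless[of k l] le by (intro gmono) auto
  have gyle: "g j (y k) \<le> g j (y l)" if "j \<in> J" "k \<le> l" "l < m" for j k l
    using gy[of j k l] that by (cases "k = l") auto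
  have gpos: "0 < g j (y k)" if "j \<in> J" "k < m" for j k
    using gmono[of j 0 "y k"] that Jm[OF that(1)] ypos[of k] le by (auto simp: g_def arctan_gap_def)
  have \<rho>pos: "0 < \<rho> j k" if "j \<in> J" "k \<in> J" for j k
    unfolding \<rho>_def using gy[of j k "Suc k"] that Jm[OF that(2)] by auto
  have gap: "g j Y = \<theta> j - \<theta> (Suc j)" for j by (simp add: g_def \<theta>_def arctan_gap_def)
  have \<theta>less: "\<theta> j < \<theta> i" if "i < j" "j < m" for i j
    unfolding \<theta>_def using xless[OF that] xpos[of i] Y(1)[OF that(2)] that
    by (intro arctan_monotone divide_strict_left_mono) auto
  have \<theta>le: "\<theta> j \<le> \<theta> i" if "i \<le> j" "j < m" for i j
    using \<theta>less[of i j] that by (cases "i = j") auto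
  have distinct: "\<rho> i k \<noteq> \<rho> i l \<or> \<rho> j k \<noteq> \<rho> j l"
    if "i \<in> J" "j \<in> J" "i < j" "k \<in> J" "l \<in> J" "k < l" for i j k l
  proof -
    note lt = Jm[OF that(1)] Jm[OF that(2)] Jm[OF that(4)] Jm[OF that(5)]
    have "0 \<le> y k" using ypos[of k] lt by simp
    then have "\<rho> i k = \<rho> i l \<Longrightarrow> \<rho> j k \<noteq> \<rho> j l"
      unfolding \<rho>_def g_def using lt that
      by (intro arctan_gap_increments_distinct) (auto intro: xpos xless xle yless yle le less_imp_le ypos)
    then show ?thesis by blast
  qed
  have inj: "inj_on (\<lambda>k. (\<rho> i k, \<rho> j k)) J" if "i \<in> J" "j \<in> J" "i \<noteq> j" for i j
    using that distinct by (intro inj_onI) (metis Pair_inject nat_neq_iff)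
  obtain i where i: "i \<in> J" "\<And>j. j \<in> J \<Longrightarrow> g i Y \<le> g j Y"
  proof -
    have "J \<noteq> {}" using m J(2) by force
    from ex_is_arg_min_if_finite[OF J(1) this, of "\<lambda>j. g j Y"] show ?thesis
      using that by (auto simp: is_arg_min_linorder)
  qed
  \<comment> \<open>Dropping \<open>i\<close> from the outer index in \<open>embed\<close> makes
    both \<open>i\<close> and \<open>i'\<close> admissible there: each has gap at most
    \<open>g j Y\<close> for every remaining \<open>j\<close>.\<close>
  obtain i' where i': "i' \<in> J - {i}" "\<And>j. j \<in> J - {i} \<Longrightarrow> g i' Y \<le> g j Y"
  proof -
    have "finite (J - {i})" using J by simp
    moreover have "0 \<in> J" "1 \<in> J" using m by (auto simp: J_def)
    then have "J - {i} \<noteq> {}" by (metis Diff_eq_empty_iff singletonD subsetD zero_neq_one)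
    ultimately show ?thesis using ex_is_arg_min_if_finite[of "J - {i}" "\<lambda>j. g j Y"] that
      by (auto simp: is_arg_min_linorder)
  qed
  \<comment> \<open>The component \<open>r\<close> is the value of an increment rather than its
    index, so equal increments count once. The size of \<open>P j\<close> is then the sum of ranks
    bounded by \<open>sum_ranks_ge\<close>.\<close>
  define P where "P j = (SIGMA k:J. {r \<in> \<rho> j ` J. r \<le> \<rho> j k})" for j
  have finP: "finite (P j)" for j unfolding P_def using J by auto
  have cardP: "card (P j) = (\<Sum>k\<in>J. card {r \<in> \<rho> j ` J. r \<le> \<rho> j k})" for j
    unfolding P_def using J by (subst card_SigmaI) auto
  have finS: "finite ?S" by (rule finite_sums_4_3[OF finT])
  have embed: "card (J - {i}) * card (P h) \<le> card ?S" if h: "h \<in> J" "\<And>j. j \<in> J - {i} \<Longrightarrow> g h Y \<le> g j Y" for h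
  proof -
    \<comment> \<open>As \<theta> decreases, the image lies in the half-open interval from
      \<open>\<theta> (Suc j)\<close> to \<open>\<theta> j\<close>, which reveals \<open>j\<close>.
      The remainder lies in the half-open interval from \<open>g h (y k)\<close> to
      \<open>g h (y (Suc k))\<close>, which reveals \<open>k\<close> and then
      \<open>r\<close>.\<close>
    let ?\<phi> = "\<lambda>(j, k, r). \<theta> (Suc j) + (g h (y k) + r)"
    have r: "0 < r \<and> r \<le> g h (y (Suc k)) - g h (y k) \<and> k \<in> J" if "(k, r) \<in> P h" for k r
      using that \<rho>pos[OF h(1)] by (auto simp: P_def \<rho>_def)
    have w: "0 < g h (y k) + r \<and> g h (y k) + r \<le> \<theta> j - \<theta> (Suc j)" if "(k, r) \<in> P h" "j \<in> J - {i}" for k r j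
    proof -
      have "k \<in> J" using r[OF that(1)] by simp
      then have "g h (y (Suc k)) \<le> g h Y" using gyle[OF h(1), of "Suc k" "m - 1"] m
        by (auto simp: Y_def J_def)
      then show ?thesis using r[OF that(1)] gpos[OF h(1), of k] h(2)[OF that(2)] Jm[OF \<open>k \<in> J\<close>]
        unfolding gap[symmetric] by auto
    qed
    have jne: False if "(k, r) \<in> P h" "(k', r') \<in> P h" "j \<in> J - {i}" "j' \<in> J - {i}" "j < j'"
      "\<theta> (Suc j) + (g h (y k) + r) = \<theta> (Suc j') + (g h (y k') + r')" for j j' k k' r r'
      using w[OF that(1,3)] w[OF that(2,4)] \<theta>le[of "Suc j" j'] Jm[of j'] that by auto
    have kne: False if "(k, r) \<in> P h" "(k', r') \<in> P h" "k < k'" "g h (y k) + r = g h (y k') + r'" for k k' r r'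
      using r[OF that(1)] r[OF that(2)] gyle[OF h(1), of "Suc k" k'] Jm[of k'] that by auto
    have "inj_on ?\<phi> ((J - {i}) \<times> P h)"
    proof (rule inj_onI)
      fix e e' assume e: "e \<in> (J - {i}) \<times> P h" "e' \<in> (J - {i}) \<times> P h" "?\<phi> e = ?\<phi> e'"
      obtain j k r j' k' r' where ee: "e = (j, k, r)" "e' = (j', k', r')" by (metis surj_pair)
      have *: "j \<in> J" "(k, r) \<in> P h" "j' \<in> J" "(k', r') \<in> P h" "j \<noteq> i" "j' \<noteq> i"
        and eq: "\<theta> (Suc j) + (g h (y k) + r) = \<theta> (Suc j') + (g h (y k') + r')"
        using e unfolding ee by auto
      from * eq have "j = j'"
        using jne[of k r k' r' j j'] jne[of k' r' k r j' j] by (metis Diff_iff nat_neq_iff singletonD)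
      moreover from this eq have "g h (y k) + r = g h (y k') + r'" by simp
      moreover from this have "k = k'"
        using kne[of k r k' r'] kne[of k' r' k r] * by (metis nat_neq_iff)
      ultimately show "e = e'" unfolding ee by auto
    qed
    moreover have "?\<phi> ` ((J - {i}) \<times> P h) \<subseteq> ?S"
    proof (rule image_subsetI)
      fix e assume e: "e \<in> (J - {i}) \<times> P h"
      obtain j k r where ee: "e = (j, k, r)" by (metis surj_pair)
      have *: "j \<in> J" "(k, r) \<in> P h" using e unfolding ee by auto
      then obtain l where l: "l \<in> J" "k \<in> J" "r = \<rho> h l" by (auto simp: P_def)
      let ?t = "\<lambda>i j. arctan (y i / x j)"
      have "\<theta> (Suc j) + (g h (y k) + r) =
          ?t (m - 1) (Suc j) + ?t k h + ?t (Suc l) h + ?t l (Suc h) - (?t k (Suc h) + ?t (Suc l) (Suc h) + ?t l h)"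
        by (simp add: \<theta>_def Y_def g_def arctan_gap_def \<rho>_def l)
      moreover have "?t (m - 1) (Suc j) \<in> T" "?t k h \<in> T" "?t (Suc l) h \<in> T" "?t l (Suc h) \<in> T"
          "?t k (Suc h) \<in> T" "?t (Suc l) (Suc h) \<in> T" "?t l h \<in> T"
        using Jm[OF *(1)] Jm[OF l(1)] Jm[OF l(2)] Jm[OF h(1)] by (auto intro!: T)
      ultimately have "\<theta> (Suc j) + (g h (y k) + r) \<in> ?S" unfolding sums_4_3_def by blast
      then show "?\<phi> e \<in> ?S" unfolding ee by simp
    qed
    ultimately have "card ((J - {i}) \<times> P h) \<le> card ?S" using finS by (rule card_inj_on_le)
    then show ?thesis by (simp add: card_cartesian_product)
  qed
  have cardJi: "card (J - {i}) = m - 2" using i J by simp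
  have "(m - 1) * s \<le> 2 * (card (P i) + card (P i'))"
    using sum_ranks_ge[OF J(1) inj[of i i']] i i' m unfolding J(2) cardP by auto
  then have "(m - 2) * ((m - 1) * s) \<le> (m - 2) * (2 * (card (P i) + card (P i')))" by simp
  also have "\<dots> = 2 * ((m - 2) * card (P i) + (m - 2) * card (P i'))" by (simp add: algebra_simps)
  also have "(m - 2) * card (P i) \<le> card ?S" using embed[of i] i cardJi by auto
  also have "(m - 2) * card (P i') \<le> card ?S" using embed[of i'] i' cardJi by auto
  finally show ?thesis by simp
qed

section \<open>Directions and angles at a vertex\<close>

lemma ex_strict_mono_enum:
  fixes S :: "real set"
  assumes "finite S" "m \<le> card S"
  obtains x where "strict_mono_on {..<m} x" "\<And>i. i < m \<Longrightarrow> x i \<in> S"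
proof (rule that[of "(!) (sorted_list_of_set S)"])
  show "strict_mono_on {..<m} ((!) (sorted_list_of_set S))"
    using assms sorted_wrt_nth_less[OF strict_sorted_list_of_set[of S]]
    by (auto simp: strict_mono_on_def)
  show "sorted_list_of_set S ! i \<in> S" if "i < m" for i
    using assms that by (metis length_sorted_list_of_set less_le_trans nth_mem set_sorted_list_of_set)
qed

text \<open>At least 4m elements of \<open>B\<close> differ from \<open>x\<close>, so one side of
  \<open>x\<close> holds 2m of them; the sign \<sigma> records which. The even number 2m leaves room
  to split the enumeration into a lower and an upper half.\<close>

lemma ex_one_sided_enum:
  fixes B :: "real set"
  assumes "finite B" "4 * m + 1 \<le> card B"
  obtains \<sigma> :: real and a where "\<sigma> \<in> {1, -1}" "strict_mono_on {..<2 * m} a"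
    "\<And>i. i < 2 * m \<Longrightarrow> 0 < a i \<and> x + \<sigma> * a i \<in> B"
proof -
  define D where "D \<sigma> = {d. 0 < d \<and> x + \<sigma> * d \<in> B}" for \<sigma>
  have inj: "inj_on (\<lambda>d. x + \<sigma> * d) (D \<sigma>)" if "\<sigma> \<in> {1, -1}" for \<sigma> using that by (auto simp: inj_on_def)
  have sub: "(\<lambda>d. x + \<sigma> * d) ` D \<sigma> \<subseteq> B" for \<sigma> by (auto simp: D_def)
  have fin: "finite (D \<sigma>)" if "\<sigma> \<in> {1, -1}" for \<sigma>
    using inj_on_finite[OF inj[OF that] sub assms(1)] .
  have "b \<in> {x} \<union> (\<lambda>d. x + d) ` D 1 \<union> (\<lambda>d. x - d) ` D (- 1)" if "b \<in> B" for b
  proof -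
    have "b < x \<Longrightarrow> x - b \<in> D (- 1) \<and> b = x - (x - b)" "x < b \<Longrightarrow> b - x \<in> D 1 \<and> b = x + (b - x)"
      using that by (auto simp: D_def)
    then show ?thesis by (metis (no_types, lifting) UnCI imageI insertI1 linorder_neqE_linordered_idom)
  qed
  then have "card B \<le> card ({x} \<union> (\<lambda>d. x + d) ` D 1 \<union> (\<lambda>d. x - d) ` D (- 1))"
    using fin by (intro card_mono) auto
  also have "\<dots> \<le> card ({x} \<union> (\<lambda>d. x + d) ` D 1) + card ((\<lambda>d. x - d) ` D (- 1))" by (rule card_Un_le)
  also have "\<dots> \<le> card {x} + card ((\<lambda>d. x + d) ` D 1) + card ((\<lambda>d. x - d) ` D (- 1))"
    by (intro add_mono card_Un_le) auto
  also have "\<dots> \<le> 1 + card (D 1) + card (D (- 1))"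
    using fin by (intro add_mono card_image_le) auto
  finally have "2 * m \<le> card (D 1) \<or> 2 * m \<le> card (D (- 1))" using assms(2) by linarith
  then obtain \<sigma> where \<sigma>: "\<sigma> \<in> {1, -1}" "2 * m \<le> card (D \<sigma>)" by auto
  obtain a where "strict_mono_on {..<2 * m} a" "\<And>i. i < 2 * m \<Longrightarrow> a i \<in> D \<sigma>"
    using ex_strict_mono_enum[OF fin[OF \<sigma>(1)] \<sigma>(2)] by blast
  then show thesis using that[of \<sigma> a] \<sigma>(1) by (auto simp: D_def)
qed

text \<open>Since 4 - 3 = 1, the seven-term sum commutes with an affine map. This transfers the
  bound through reflections in the axes and in the diagonal, which act on directions by changing
  sign and by passing to the complement to pi/2.\<close>

lemma card_sums_4_3_affine:
  fixes A :: "real set"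
  assumes "finite A"
  shows "card (sums_4_3 ((\<lambda>t. u + v * t) ` A)) \<le> card (sums_4_3 A)"
proof -
  have "sums_4_3 ((\<lambda>t. u + v * t) ` A) \<subseteq> (\<lambda>t. u + v * t) ` sums_4_3 A"
  proof
    fix s assume "s \<in> sums_4_3 ((\<lambda>t. u + v * t) ` A)"
    then obtain a b c d e f g where "s = (u + v * a) + (u + v * b) + (u + v * c) + (u + v * d)
        - ((u + v * e) + (u + v * f) + (u + v * g))"
      and A: "a \<in> A" "b \<in> A" "c \<in> A" "d \<in> A" "e \<in> A" "f \<in> A" "g \<in> A"
      unfolding sums_4_3_def by blast
    then have "s = u + v * (a + b + c + d - (e + f + g))" by (simp add: algebra_simps)
    moreover have "a + b + c + d - (e + f + g) \<in> sums_4_3 A" using A unfolding sums_4_3_def by blast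
    ultimately show "s \<in> (\<lambda>t. u + v * t) ` sums_4_3 A" by blast
  qed
  then have "card (sums_4_3 ((\<lambda>t. u + v * t) ` A)) \<le> card ((\<lambda>t. u + v * t) ` sums_4_3 A)"
    using finite_sums_4_3[OF assms] by (intro card_mono) auto
  also have "\<dots> \<le> card (sums_4_3 A)" using finite_sums_4_3[OF assms] by (rule card_image_le)
  finally show ?thesis .
qed

text \<open>Real representatives in the interval from -pi/2 to pi/2 are used instead of classes
  modulo pi, because squeezing needs the order of the reals. The vertical direction is left
  out.\<close>

definition directions :: "real set \<Rightarrow> real \<Rightarrow> real \<Rightarrow> real set" where
  "directions B x y = {arctan ((c - y) / (b - x)) | b c. b \<in> B \<and> c \<in> B \<and> b \<noteq> x}"

lemma finite_directions:
  assumes "finite B" shows "finite (directions B x y)"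
  by (rule finite_subset[of _ "(\<lambda>(b, c). arctan ((c - y) / (b - x))) ` (B \<times> B)"])
    (use assms in \<open>auto simp: directions_def\<close>)

lemma card_directions:
  assumes "finite B"
  shows "card (directions B x y) = card {(c - y) / (b - x) | b c. b \<in> B \<and> c \<in> B \<and> b \<noteq> x}"
proof -
  have "directions B x y = arctan ` {(c - y) / (b - x) | b c. b \<in> B \<and> c \<in> B \<and> b \<noteq> x}"
    unfolding directions_def by blast
  then show ?thesis by (simp add: card_image inj_on_def arctan_eq_iff)
qed

text \<open>Work in a quadrant at the vertex with 2m abscissae \<open>a\<close> and 2m ordinates
  \<open>b\<close>. Comparing \<open>b (m - 1)\<close> with \<open>a m\<close> shows that the lower
  half of one sequence stays below the upper half of the other. If it is \<open>a\<close> that stays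
  below, the axes are exchanged, which replaces a direction by its complement to pi/2.\<close>

lemma sums_4_3_directions_ge:
  assumes B: "finite B" "4 * m + 1 \<le> card B" and m: "m \<ge> 3" "2 * (s * s) \<le> m - 1"
  shows "(m - 2) * ((m - 1) * s) \<le> 4 * card (sums_4_3 (directions B x y))"
proof -
  let ?D = "directions B x y"
  note fin = finite_directions[OF B(1), of x y]
  obtain \<sigma> :: real and a where a: "\<sigma> \<in> {1, -1}" "strict_mono_on {..<2 * m} a"
    "\<And>i. i < 2 * m \<Longrightarrow> 0 < a i \<and> x + \<sigma> * a i \<in> B"
    using ex_one_sided_enum[OF B, of x] by blast
  obtain \<tau> :: real and b where b: "\<tau> \<in> {1, -1}" "strict_mono_on {..<2 * m} b"
    "\<And>i. i < 2 * m \<Longrightarrow> 0 < b i \<and> y + \<tau> * b i \<in> B"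
    using ex_one_sided_enum[OF B, of y] by blast
  have less: "a i < a j" "b i < b j" if "i < j" "j < 2 * m" for i j
    using a(2) b(2) that by (auto simp: strict_mono_on_def)
  have le: "a i \<le> a j" "b i \<le> b j" if "i \<le> j" "j < 2 * m" for i j
    using less[of i j] that by (cases "i = j"; auto)+
  have dir: "\<sigma> * \<tau> * arctan (b j / a i) \<in> ?D" if "i < 2 * m" "j < 2 * m" for i j
  proof -
    have "x + \<sigma> * a i \<in> B" "x + \<sigma> * a i \<noteq> x" "y + \<tau> * b j \<in> B"
      using a(1) a(3)[OF that(1)] b(3)[OF that(2)] by auto
    then have "arctan ((y + \<tau> * b j - y) / (x + \<sigma> * a i - x)) \<in> ?D"
      unfolding directions_def by blast
    moreover have "arctan ((y + \<tau> * b j - y) / (x + \<sigma> * a i - x)) = \<sigma> * \<tau> * arctan (b j / a i)"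
      using a(1) b(1) by (auto simp: arctan_minus)
    ultimately show ?thesis by simp
  qed
  have st: "(\<sigma> * \<tau>) * (\<sigma> * \<tau>) = 1" using a(1) b(1) by auto
  have st': "\<sigma> * \<tau> * (\<sigma> * \<tau> * z) = z" for z using st by (metis mult.assoc mult_1)
  consider "b (m - 1) \<le> a m" | "a m \<le> b (m - 1)" by linarith
  then show ?thesis
  proof cases
    case 1
    let ?T = "(\<lambda>t. 0 + (\<sigma> * \<tau>) * t) ` ?D"
    have "(m - 2) * ((m - 1) * s) \<le> 4 * card (sums_4_3 ?T)"
    proof (rule squeezing_enumerated[OF m, where x = "\<lambda>i. a (m + i)" and y = b])
      show "strict_mono_on {..<m} (\<lambda>i. a (m + i))" "strict_mono_on {..<m} b"
        using less by (auto simp: strict_mono_on_def)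
      show "0 < b i" if "i < m" for i using b(3)[of i] that by simp
      show "b i \<le> a (m + j)" if "i < m" "j < m" for i j
      proof -
        have "i \<le> m - 1" "m - 1 < 2 * m" "m + j < 2 * m" using that by linarith+
        then show ?thesis using le(2)[of i "m - 1"] le(1)[of m "m + j"] 1 by simp
      qed
      show "arctan (b i / a (m + j)) \<in> ?T" if "i < m" "j < m" for i j
        by (rule image_eqI[OF _ dir[of "m + j" i]]) (use that st' in auto)
      show "finite ?T" using fin by simp
    qed
    then show ?thesis using card_sums_4_3_affine[OF fin, of 0 "\<sigma> * \<tau>"] by linarith
  next
    case 2
    let ?T = "(\<lambda>t. pi / 2 + (- (\<sigma> * \<tau>)) * t) ` ?D"
    have "(m - 2) * ((m - 1) * s) \<le> 4 * card (sums_4_3 ?T)"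
    proof (rule squeezing_enumerated[OF m, where x = "\<lambda>i. b (m + i)" and y = a])
      show "strict_mono_on {..<m} (\<lambda>i. b (m + i))" "strict_mono_on {..<m} a"
        using less by (auto simp: strict_mono_on_def)
      show "0 < a i" if "i < m" for i using a(3)[of i] that by simp
      show "a i \<le> b (m + j)" if "i < m" "j < m" for i j
      proof -
        have "m < 2 * m" "m - 1 \<le> m + j" "m + j < 2 * m" using that by linarith+
        then show ?thesis using le(1)[of i m] le(2)[of "m - 1" "m + j"] 2 that by simp
      qed
      show "arctan (a i / b (m + j)) \<in> ?T" if "i < m" "j < m" for i j
      proof (rule image_eqI[OF _ dir[of i "m + j"]])
        have "0 < b (m + j) / a i" using a(3)[of i] b(3)[of "m + j"] that by simp
        then have "arctan (a i / b (m + j)) = pi / 2 - arctan (b (m + j) / a i)"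
          using arctan_inverse[of "b (m + j) / a i"] by simp
        then show "arctan (a i / b (m + j)) =
            pi / 2 + - (\<sigma> * \<tau>) * (\<sigma> * \<tau> * arctan (b (m + j) / a i))"
          using st'[of "arctan (b (m + j) / a i)"] by simp
      qed (use that in auto)
      show "finite ?T" using fin by simp
    qed
    then show ?thesis using card_sums_4_3_affine[OF fin, of "pi / 2" "- (\<sigma> * \<tau>)"] by linarith
  qed
qed

text \<open>A direction forgets the orientation of a vector, so a difference of directions gives the
  angle only up to sign and modulo pi. The squared cosine is blind to both.\<close>

lemma cos_angle_squared:
  assumes "fst p \<noteq> fst q" "fst r \<noteq> fst q"
  shows "(cos (angle p q r))\<^sup>2 =
    (cos (arctan ((snd p - snd q) / (fst p - fst q)) - arctan ((snd r - snd q) / (fst r - fst q))))\<^sup>2"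
proof -
  define d where "d = fst p - fst q"
  define e where "e = fst r - fst q"
  define s where "s = (snd p - snd q) / d"
  define t where "t = (snd r - snd q) / e"
  have nz: "d \<noteq> 0" "e \<noteq> 0" using assms by (auto simp: d_def e_def)
  have p: "p - q = (d, d * s)" and r: "r - q = (e, e * t)"
    using nz by (auto simp: prod_eq_iff d_def e_def s_def t_def)
  have pos: "1 + s\<^sup>2 > 0" "1 + t\<^sup>2 > 0" by (simp_all add: add_pos_nonneg)
  let ?I = "(p - q) \<bullet> (r - q)"
  let ?N = "norm (p - q) * norm (r - q)"
  have "p \<noteq> q" "r \<noteq> q" using assms by auto
  then have N: "0 < ?N" by simp
  have "\<bar>?I / ?N\<bar> = \<bar>?I\<bar> / ?N" using N by (simp only: abs_divide abs_of_pos)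
  also have "\<dots> \<le> 1" using Cauchy_Schwarz_ineq2 divide_le_eq_1_pos[OF N] by blast
  finally have "\<bar>?I / ?N\<bar> \<le> 1" .
  then have "(cos (angle p q r))\<^sup>2 = (?I / ?N)\<^sup>2"
    unfolding angle_def by (subst cos_arccos_abs) auto
  also have "\<dots> = (d * e * (1 + s * t))\<^sup>2 / ((d\<^sup>2 * (1 + s\<^sup>2)) * (e\<^sup>2 * (1 + t\<^sup>2)))"
    unfolding power_divide power_mult_distrib[of "norm (p - q)"] p r
    by (simp add: norm_prod_def algebra_simps power_mult_distrib)
  also have "\<dots> = (1 + s * t)\<^sup>2 / ((1 + s\<^sup>2) * (1 + t\<^sup>2))"
    using nz pos by (simp add: power_mult_distrib divide_simps)
  also have "\<dots> = (cos (arctan s - arctan t))\<^sup>2"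
  proof -
    have "cos (arctan s - arctan t) = (1 + s * t) / (sqrt (1 + s\<^sup>2) * sqrt (1 + t\<^sup>2))"
      by (simp add: cos_diff cos_arctan sin_arctan add_divide_distrib)
    then show ?thesis using pos by (simp add: power_divide power_mult_distrib)
  qed
  finally show ?thesis unfolding s_def t_def d_def e_def .
qed

lemma card_cos_squared_fiber:
  assumes "D \<subseteq> {-pi..pi}"
  shows "card {\<delta> \<in> D. (cos \<delta>)\<^sup>2 = v} \<le> 4"
proof -
  let ?c = "sqrt v"
  have "{\<delta> \<in> D. (cos \<delta>)\<^sup>2 = v} \<subseteq> set [arccos ?c, - arccos ?c, arccos (- ?c), - arccos (- ?c)]"
  proof
    fix \<delta> assume "\<delta> \<in> {\<delta> \<in> D. (cos \<delta>)\<^sup>2 = v}"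
    then have \<delta>: "- pi \<le> \<delta>" "\<delta> \<le> pi" "(cos \<delta>)\<^sup>2 = v" using assms by auto
    have "arccos (cos \<delta>) = \<bar>\<delta>\<bar>" using \<delta> arccos_cos[of "\<bar>\<delta>\<bar>"] by simp
    moreover have "cos \<delta> = ?c \<or> cos \<delta> = - ?c" using \<delta>(3) by (auto simp: real_sqrt_abs)
    ultimately show "\<delta> \<in> set [arccos ?c, - arccos ?c, arccos (- ?c), - arccos (- ?c)]"
      by (auto simp: abs_if split: if_splits)
  qed
  then have "card {\<delta> \<in> D. (cos \<delta>)\<^sup>2 = v} \<le> card (set [arccos ?c, - arccos ?c, arccos (- ?c), - arccos (- ?c)])"
    by (intro card_mono) auto
  also have "\<dots> \<le> 4" using card_length[of "[arccos ?c, - arccos ?c, arccos (- ?c), - arccos (- ?c)]"] by simp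
  finally show ?thesis .
qed

lemma finite_angles:
  assumes "finite P" shows "finite (angles P)"
proof -
  have "angles P \<subseteq> (\<Union>p\<in>P. \<Union>q\<in>P. \<Union>r\<in>P. {angle p q r})" unfolding angles_def by blast
  then show ?thesis using assms by (auto intro: finite_subset)
qed

lemma angles_at_subset: "q \<in> P \<Longrightarrow> angles_at q P \<subseteq> angles P"
  unfolding angles_at_def angles_def by blast

text \<open>The squared cosine takes each value at most four times on differences in the interval
  from -pi to pi. The difference 0 is treated apart, since it may come from p = r, and is paid for
  by the existence of one angle; hence 5 = 4 + 1.\<close>

lemma card_direction_differences_le:
  assumes "finite B" "x \<in> B" "y \<in> B" "card B \<ge> 2"
  shows "1 \<le> card (angles_at (x, y) (B \<times> B))"
    and "card (directions B x y + uminus ` directions B x y) \<le> 5 * card (angles_at (x, y) (B \<times> B))"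
proof -
  let ?A = "angles_at (x, y) (B \<times> B)"
  let ?\<Theta> = "directions B x y"
  let ?D = "?\<Theta> + uminus ` ?\<Theta>"
  have finA: "finite ?A"
    using angles_at_subset[of "(x, y)" "B \<times> B"] finite_angles[of "B \<times> B"] assms
    by (auto intro: finite_subset)
  have finD: "finite ?D" using finite_directions[OF assms(1)] by (intro finite_set_plus) auto
  have "B - {x} \<noteq> {}" "B - {y} \<noteq> {}"
    using assms by (auto simp: subset_singleton_iff dest!: Diff_eq_empty_iff[THEN iffD1])
  then obtain x' y' where "x' \<in> B" "x' \<noteq> x" "y' \<in> B" "y' \<noteq> y" by blast
  then have "angle (x', y) (x, y) (x, y') \<in> ?A" unfolding angles_at_def using assms(2,3) by blast
  then show A1: "1 \<le> card ?A" using finA by (metis One_nat_def Suc_leI card_gt_0_iff empty_iff)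
  let ?h = "\<lambda>\<delta>::real. (cos \<delta>)\<^sup>2"
  have bounds: "?D \<subseteq> {-pi..pi}"
  proof
    fix \<delta> assume "\<delta> \<in> ?D"
    then obtain s t where "\<delta> = arctan s - arctan t" by (auto simp: directions_def set_plus_def)
    then show "\<delta> \<in> {-pi..pi}"
      using arctan_bounded[of s] arctan_bounded[of t] by auto
  qed
  have "?h ` (?D - {0}) \<subseteq> ?h ` ?A"
  proof (rule image_subsetI)
    fix \<delta> assume \<delta>: "\<delta> \<in> ?D - {0}"
    then obtain \<theta> \<theta>' where \<theta>: "\<theta> \<in> ?\<Theta>" "\<theta>' \<in> ?\<Theta>" "\<delta> = \<theta> - \<theta>'"
      by (auto simp: set_plus_def)
    obtain b c b' c' where bc: "b \<in> B" "c \<in> B" "b \<noteq> x" "\<theta> = arctan ((c - y) / (b - x))"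
      "b' \<in> B" "c' \<in> B" "b' \<noteq> x" "\<theta>' = arctan ((c' - y) / (b' - x))"
      using \<theta>(1,2) unfolding directions_def by blast
    have "(b, c) \<noteq> (b', c')" using \<delta> \<theta>(3) bc by auto
    then have "angle (b, c) (x, y) (b', c') \<in> ?A" unfolding angles_at_def using bc by blast
    moreover have "?h (angle (b, c) (x, y) (b', c')) = ?h \<delta>"
      using cos_angle_squared[of "(b, c)" "(x, y)" "(b', c')"] bc \<theta>(3) by simp
    ultimately show "?h \<delta> \<in> ?h ` ?A" by (metis imageI)
  qed
  then have "card (?h ` (?D - {0})) \<le> card (?h ` ?A)" using finA by (intro card_mono) auto
  also have "\<dots> \<le> card ?A" using finA by (rule card_image_le)
  finally have "card (?h ` (?D - {0})) * 4 \<le> card ?A * 4" by simp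
  moreover have "card (?D - {0}) \<le> card (?h ` (?D - {0})) * 4"
    by (rule card_le_fibers) (use finD card_cos_squared_fiber[of "?D - {0}"] bounds in auto)
  moreover have "card ?D \<le> card (?D - {0}) + 1"
    using card_Diff_singleton_if[of ?D 0] by auto
  ultimately show "card ?D \<le> 5 * card ?A" using A1 by linarith
qed

section \<open>Numerical constants and the final exponent\<close>

lemma sums_4_3_directions_growth:
  assumes "finite B" "card B \<ge> 256"
  shows "real (card B) ^ 2 * sqrt (real (card B)) \<le> 2 ^ 12 * real (card (sums_4_3 (directions B x y)))"
proof -
  define n where "n = card B"
  define m where "m = (n - 1) div 4"
  \<comment> \<open>The divisor 8 gives 2 s^2 \<le> n / 32, well below \<open>m - 1\<close>. With n
    \<ge> 256 the rounded number is at least 2, so rounding loses at most a factor 2. The constant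
    2^12 is then 4 * 8 * 8 * 16.\<close>
  define s where "s = nat \<lfloor>sqrt (real n) / 8\<rfloor>"
  have n: "n \<ge> 256" using assms by (simp add: n_def)
  have m4: "4 * m + 1 \<le> n" "n \<le> 4 * m + 4" using n unfolding m_def by presburger+
  have m: "real m - 2 \<ge> real n / 8" "real m - 1 \<ge> real n / 8" "m \<ge> 3"
    using m4 n by linarith+
  have "sqrt (real n) \<ge> sqrt (16\<^sup>2)" using n by (intro real_sqrt_le_mono) simp
  then have sq: "sqrt (real n) \<ge> 16" by simp
  have s: "real s \<le> sqrt (real n) / 8" "real s \<ge> sqrt (real n) / 16"
    unfolding s_def using sq by linarith+
  have "real s * real s \<le> (sqrt (real n) / 8) * (sqrt (real n) / 8)"
    using s by (intro mult_mono) auto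
  also have "\<dots> = real n / 64" by simp
  finally have "real (2 * (s * s)) \<le> real (m - 1)" using m by (simp add: of_nat_diff)
  then have ss: "2 * (s * s) \<le> m - 1" by (simp only: of_nat_le_iff)
  have "(m - 2) * ((m - 1) * s) \<le> 4 * card (sums_4_3 (directions B x y))"
    using assms(1) m4 m(3) ss by (intro sums_4_3_directions_ge) (simp_all add: n_def)
  then have "real ((m - 2) * ((m - 1) * s)) \<le> real (4 * card (sums_4_3 (directions B x y)))"
    by (rule of_nat_mono)
  then have "(real m - 2) * ((real m - 1) * real s) \<le> 4 * real (card (sums_4_3 (directions B x y)))"
    using m(3) by (simp add: of_nat_diff)
  moreover have "(real n / 8) * ((real n / 8) * (sqrt (real n) / 16)) \<le> (real m - 2) * ((real m - 1) * real s)"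
    using m s by (intro mult_mono) auto
  ultimately show ?thesis unfolding n_def[symmetric] by (simp add: power2_eq_square)
qed

lemma ex_many_angles_at:
  assumes "finite B" "card B \<ge> 2"
  obtains q where "q \<in> B \<times> B"
    "real (card (angles_at q (B \<times> B))) \<ge> 1 / 2 ^ 24 * real (card B) powr (2 + 1 / 14)"
proof -
  define n where "n = real (card B)"
  have n2: "n \<ge> 2" using assms(2) by (simp add: n_def)
  obtain x y where xy: "x \<in> B" "y \<in> B"
    "real (card {(c - y) / (b - x) | b c. b \<in> B \<and> c \<in> B \<and> b \<noteq> x}) \<ge> n ^ 2 / 2 ^ 17"
    using ex_many_slopes[OF assms] unfolding n_def by blast
  let ?\<Theta> = "directions B x y"
  let ?D = "?\<Theta> + uminus ` ?\<Theta>"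
  define A where "A = real (card (angles_at (x, y) (B \<times> B)))"
  have A1: "A \<ge> 1" and AD: "real (card ?D) \<le> 5 * A"
    using card_direction_differences_le[OF assms(1) xy(1,2) assms(2)] unfolding A_def by linarith+
  have \<Theta>: "real (card ?\<Theta>) \<ge> n ^ 2 / 2 ^ 17" using xy(3) card_directions[OF assms(1)] by simp
  \<comment> \<open>The constant 2^24 = 256^3 is dictated by the small sets, where one angle must
    already suffice.\<close>
  have "n powr (2 + 1 / 14) \<le> 2 ^ 24 * A"
  proof (cases "card B \<ge> 256")
    case True
    have "real (card (sums_4_3 ?\<Theta>) * card ?\<Theta> ^ 6) \<le> real (card ?D ^ 7)"
      by (intro of_nat_mono plunnecke_4_3 finite_directions assms(1))
    also have "\<dots> \<le> (5 * A) ^ 7" unfolding of_nat_power by (intro power_mono AD) simp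
    finally have up: "real (card (sums_4_3 ?\<Theta>)) * real (card ?\<Theta>) ^ 6 \<le> (5 * A) ^ 7" by simp
    have "(n ^ 2 * sqrt n / 2 ^ 12) * (n ^ 2 / 2 ^ 17) ^ 6
        \<le> real (card (sums_4_3 ?\<Theta>)) * real (card ?\<Theta>) ^ 6"
      using sums_4_3_directions_growth[OF assms(1) True, of x y] \<Theta> n2
      by (intro mult_mono power_mono) (simp_all add: n_def)
    with up have *: "(n ^ 2 * sqrt n / 2 ^ 12) * (n ^ 2 / 2 ^ 17) ^ 6 \<le> (5 * A) ^ 7" by linarith
    have "(n powr (2 + 1 / 14)) ^ 7 = n powr (14 + 1 / 2)"
      using n2 by (simp add: powr_power)
    also have "\<dots> = n ^ 14 * sqrt n"
      using n2 by (simp only: powr_add powr_half_sqrt) (simp add: powr_numeral)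
    \<comment> \<open>The exponent 114 is 12 + 6 * 17. It is rounded up to 119 = 7 * 17 to make the
      constant a seventh power.\<close>
    also have "\<dots> = 2 ^ 114 * ((n ^ 2 * sqrt n / 2 ^ 12) * (n ^ 2 / 2 ^ 17) ^ 6)"
      by (simp add: power_divide eval_nat_numeral)
    also have "\<dots> \<le> 2 ^ 114 * (5 * A) ^ 7" using * by (intro mult_left_mono) auto
    also have "\<dots> \<le> (2 ^ 17) ^ 7 * (5 * A) ^ 7" using A1 by (intro mult_right_mono) auto
    also have "\<dots> = (2 ^ 17 * (5 * A)) ^ 7" by (simp only: power_mult_distrib)
    finally have "n powr (2 + 1 / 14) \<le> 2 ^ 17 * (5 * A)"
      by (rule power_le_imp_le_base[of _ 6, simplified]) (use A1 in auto)
    also have "\<dots> \<le> 2 ^ 24 * A" using A1 by simp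
    finally show ?thesis .
  next
    case False
    then have "n \<le> 256" by (simp add: n_def)
    have "n powr (2 + 1 / 14) \<le> n powr 3" using n2 by (intro powr_mono) auto
    also have "\<dots> = n ^ 3" using n2 by (simp add: powr_numeral)
    also have "\<dots> \<le> 256 ^ 3" using n2 \<open>n \<le> 256\<close> by (intro power_mono) auto
    also have "\<dots> \<le> 2 ^ 24 * A" using A1 by simp
    finally show ?thesis .
  qed
  then show thesis using that[of "(x, y)"] xy unfolding A_def n_def by (simp add: field_simps)
qed

theorem theorem1:
  shows "\<exists>c::real. c > 0 \<and>
    (\<forall>B::real set. finite B \<and> card B \<ge> 2 \<longrightarrow>
       real (card (angles (B \<times> B))) \<ge> c * real (card B) powr (2 + 1 / 14) \<and>
       (\<exists>q \<in> B \<times> B. real (card (angles_at q (B \<times> B))) \<ge> c * real (card B) powr (2 + 1 / 14)))"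
proof (intro exI[of _ "1 / 2 ^ 24"] conjI allI impI)
  show "(0::real) < 1 / 2 ^ 24" by simp
  fix B :: "real set" assume "finite B \<and> card B \<ge> 2"
  then obtain q where q: "q \<in> B \<times> B"
    "real (card (angles_at q (B \<times> B))) \<ge> 1 / 2 ^ 24 * real (card B) powr (2 + 1 / 14)"
    using ex_many_angles_at by blast
  have "card (angles_at q (B \<times> B)) \<le> card (angles (B \<times> B))"
    using angles_at_subset[OF q(1)] finite_angles[of "B \<times> B"] \<open>finite B \<and> card B \<ge> 2\<close>
    by (intro card_mono) auto
  then show "real (card (angles (B \<times> B))) \<ge> 1 / 2 ^ 24 * real (card B) powr (2 + 1 / 14)"
    using q(2) by linarith
  show "\<exists>q \<in> B \<times> B. real (card (angles_at q (B \<times> B))) \<ge> 1 / 2 ^ 24 * real (card B) powr (2 + 1 / 14)"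
    using q by blast
qed

end
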